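(* Let $p$ be a prime and $n\ge 1$ an integer. The perfect kernel of the space ${\rm Sub}(\mathcal{L}_{n,p})$ is ${\rm Sub}(\mathcal{A}_{n,p})$. Moreover, the Cantor–Bendixson rank of ${\rm Sub}(\mathcal{L}_{n,p})$ is the first infinite ordinal $\omega$.
   Context: $\mathcal{L}_{n,p}=(\mathbb{Z}/p\mathbb{Z})^n\wr\mathbb{Z}=\left(\bigoplus_{\mathbb{Z}}(\mathbb{Z}/p\mathbb{Z})^n\right)\rtimes\mathbb{Z}$ (the lamplighter group, $\mathbb{Z}$ acting by shifting coordinates), and $\mathcal{A}_{n,p}=\bigoplus_{\mathbb{Z}}(\mathbb{Z}/p\mathbb{Z})^n\le\mathcal{L}_{n,p}$. For a countable group $G$, ${\rm Sub}(G)$ is the set of all subgroups of $G$, identified with a subset of $\{0,1\}^G$ via characteristic functions and given the induced product topology (so $H_i\to H$ iff for every $g\in G$ the truth value of $g\in H_i$ is eventually equal to that of $g\in H$); it is compact metrizable. The perfect kernel of a Polish space is its unique perfect subset with countable complement (the eventual value of the iterated Cantor–Bendixson derivatives, where $X'$ is the set of non-isolated points of $X$, $X^{\alpha+1}=(X^\alpha)'$, $X^\lambda=\bigcap_{\alpha<\lambda}X^\alpha$ for limit $\lambda$); the Cantor–Bendixson rank is the least ordinal $\alpha$ with $X^{\alpha}=X^{\alpha+1}$. *)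

theory Defs
  imports "HOL-Algebra.Algebra" "HOL-Analysis.Analysis"
begin

text \<open>Lamplighter group (Z/pZ)^n wr Z. An element is a pair (f,k): f x i is the
  i-th coordinate (i < n, a residue in {0..<p}) of the lamp configuration at site x in Z,
  finitely supported; k in Z is the lighter position. Z acts by shifting coordinates:
  (f,k)(g,l) = (f + g(. - k), k + l).\<close>

definition lamp_carrier :: "nat \<Rightarrow> nat \<Rightarrow> ((int \<Rightarrow> nat \<Rightarrow> int) \<times> int) set" where
  "lamp_carrier n p = {(f,k). (\<forall>x i. f x i \<in> {0..<int p}) \<and> (\<forall>x i. n \<le> i \<longrightarrow> f x i = 0)
                              \<and> finite {x. \<exists>i. f x i \<noteq> 0}}"

definition lamplighter :: "nat \<Rightarrow> nat \<Rightarrow> ((int \<Rightarrow> nat \<Rightarrow> int) \<times> int) monoid" where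
  "lamplighter n p = \<lparr>partial_object.carrier = lamp_carrier n p,
      monoid.mult = (\<lambda>(f,k) (g,l). (\<lambda>x i. (f x i + g (x - k) i) mod int p, k + l)),
      monoid.one = (\<lambda>x i. 0, 0)\<rparr>"

definition lamp_base :: "nat \<Rightarrow> nat \<Rightarrow> ((int \<Rightarrow> nat \<Rightarrow> int) \<times> int) monoid" where
  "lamp_base n p = (lamplighter n p)\<lparr>carrier := {(f,k) \<in> lamp_carrier n p. k = 0}\<rparr>"

definition sub_char :: "('a,'b) monoid_scheme \<Rightarrow> 'a set \<Rightarrow> ('a \<Rightarrow> bool)" where
  "sub_char G H = (\<lambda>g\<in>carrier G. g \<in> H)"

definition Sub_top :: "('a,'b) monoid_scheme \<Rightarrow> ('a \<Rightarrow> bool) topology" where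
  "Sub_top G = subtopology (product_topology (\<lambda>_. discrete_topology UNIV) (carrier G))
                 (sub_char G ` {H. subgroup H G})"

definition cb_deriv :: "'a topology \<Rightarrow> 'a set \<Rightarrow> 'a set" where
  "cb_deriv T S = S \<inter> (T derived_set_of S)"

definition cb_iter :: "'a topology \<Rightarrow> nat \<Rightarrow> 'a set" where
  "cb_iter T m = (cb_deriv T ^^ m) (topspace T)"

definition cb_omega :: "'a topology \<Rightarrow> 'a set" where
  "cb_omega T = (\<Inter>m. cb_iter T m)"

text \<open>The Cantor--Bendixson rank is omega: the least ordinal alpha with X^alpha = X^(alpha+1)
  is omega, i.e. no finite m works, but omega does.\<close>
definition cb_rank_is_omega :: "'a topology \<Rightarrow> bool" where
  "cb_rank_is_omega T \<longleftrightarrow> (\<forall>m. cb_iter T (Suc m) \<noteq> cb_iter T m) \<and> cb_deriv T (cb_omega T) = cb_omega T"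

definition perfect_kernel :: "'a topology \<Rightarrow> 'a set" where
  "perfect_kernel T = (THE K. K \<subseteq> topspace T \<and> closedin T K \<and> cb_deriv T K = K
                              \<and> countable (topspace T - K))"

end

theory Submission
  imports Defs "HOL-Number_Theory.Cong"
begin

text \<open>
  A subgroup \<open>H\<close> outside the base group \<open>A\<close> is given by its projection \<open>k\<int>\<close>, by its lamp part
  \<open>B = H \<inter> A\<close>, a submodule of \<open>A\<close> over the Laurent polynomials in \<open>t ^ k\<close>, and by one element over \<open>k\<close>.
  The set of leading positions of the elements of \<open>B\<close> is a union of residue classes, and division with
  remainder shows that finitely many membership conditions determine \<open>B\<close> among all submodules with the
  same leading positions. Hence every other subgroup close to \<open>H\<close> has more leading positions or a smaller
  \<open>k\<close>, so that \<open>k\<close> plus the number of missing residue classes bounds the rank of \<open>H\<close>, and there are only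
  countably many such \<open>H\<close>. Replacing zero summands of \<open>B\<close> one at a time by \<open>1 - t ^ (k * N)\<close> with \<open>N\<close>
  large gives subgroups outside \<open>A\<close> of arbitrarily large finite rank. Finally every neighbourhood of a
  subgroup of \<open>A\<close> contains uncountably many subgroups of \<open>A\<close>, which yields both perfectness and
  uniqueness of the kernel.
\<close>

subsection \<open>Cantor--Bendixson derivatives of spaces of subgroups\<close>

text \<open>The derivative expressed on subgroups themselves: the \<open>H'\<close> that agree with
  \<open>H\<close> on a finite set \<open>F\<close> form a neighbourhood base of \<open>H\<close>.
  Elements of \<open>F\<close> outside the group are harmless, since no subgroup contains
  them.\<close>

definition accum_subgroups :: "'a set set \<Rightarrow> 'a set set" where
  "accum_subgroups S = {H \<in> S. \<forall>F. finite F \<longrightarrow> (\<exists>H'\<in>S. H' \<noteq> H \<and> H' \<inter> F = H \<inter> F)}"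

lemma topspace_Sub_top: "topspace (Sub_top G) = sub_char G ` {H. subgroup H G}"
  by (auto simp: Sub_top_def sub_char_def)

lemma sub_char_eq_iff:
  assumes "subgroup H G" "subgroup H' G"
  shows "sub_char G H = sub_char G H' \<longleftrightarrow> H = H'"
proof
  assume eq: "sub_char G H = sub_char G H'"
  have "x \<in> H \<longleftrightarrow> x \<in> H'" if "x \<in> carrier G" for x
    using fun_cong[OF eq, of x] that by (simp add: sub_char_def)
  then show "H = H'"
    using subgroup.subset[OF assms(1)] subgroup.subset[OF assms(2)] by blast
qed simp

text \<open>A basic open set of the product restricts finitely many coordinates, and over discrete
  two-point factors this means prescribing finitely many membership relations.\<close>

lemma derived_set_of_Sub_top_iff:
  assumes H: "subgroup H G" and S: "S \<subseteq> {H. subgroup H G}"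
  shows "sub_char G H \<in> Sub_top G derived_set_of (sub_char G ` S) \<longleftrightarrow>
           (\<forall>F. finite F \<longrightarrow> (\<exists>H'\<in>S. H' \<noteq> H \<and> H' \<inter> F = H \<inter> F))"
    (is "?L \<longleftrightarrow> ?R")
proof
  assume L: ?L
  show ?R
  proof (intro allI impI)
    fix F :: "'a set" assume "finite F"
    define F' where "F' = F \<inter> carrier G"
    have F': "finite F'" "F' \<subseteq> carrier G" using \<open>finite F\<close> by (auto simp: F'_def)
    \<comment> \<open>The open box that fixes the truth value of membership at each point of
      \<open>F'\<close> and leaves every other coordinate free.\<close>
    define N where "N = (\<lambda>x. if x \<in> F' then {x \<in> H} else UNIV)"
    have "openin (product_topology (\<lambda>_. discrete_topology UNIV) (carrier G)) (Pi\<^sub>E (carrier G) N)"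
      by (rule product_topology_basis) (auto simp: N_def intro: finite_subset[OF _ F'(1)])
    then have op: "openin (Sub_top G) (Pi\<^sub>E (carrier G) N \<inter> sub_char G ` {H. subgroup H G})"
      unfolding Sub_top_def openin_subtopology by blast
    have "sub_char G H \<in> Pi\<^sub>E (carrier G) N \<inter> sub_char G ` {H. subgroup H G}"
      using H by (auto simp: sub_char_def N_def)
    then have "\<exists>y. y \<noteq> sub_char G H \<and> y \<in> sub_char G ` S \<and>
                 y \<in> Pi\<^sub>E (carrier G) N \<inter> sub_char G ` {H. subgroup H G}"
      using L[unfolded in_derived_set_of, THEN conjunct2, rule_format, OF conjI[OF _ op]] by simp
    then obtain y where y: "y \<noteq> sub_char G H" "y \<in> sub_char G ` S" "y \<in> Pi\<^sub>E (carrier G) N"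
      by (elim exE conjE IntE)
    then obtain H' where H': "H' \<in> S" "y = sub_char G H'" by blast
    have "x \<in> H' \<longleftrightarrow> x \<in> H" if "x \<in> F'" for x
      using PiE_mem[OF y(3), of x] that F'(2) H'(2) by (auto simp: N_def sub_char_def)
    then have "H' \<inter> F = H \<inter> F"
      using subgroup.subset[OF H] subgroup.subset[of H' G] H'(1) S unfolding F'_def by blast
    moreover have "H' \<noteq> H" using y H' by auto
    ultimately show "\<exists>H'\<in>S. H' \<noteq> H \<and> H' \<inter> F = H \<inter> F" using H' by blast
  qed
next
  assume R: ?R
  show ?L
    unfolding in_derived_set_of
  proof (intro conjI allI impI)
    show "sub_char G H \<in> topspace (Sub_top G)" using H by (auto simp: topspace_Sub_top)
    fix T assume T: "sub_char G H \<in> T \<and> openin (Sub_top G) T"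
    then obtain U where U: "openin (product_topology (\<lambda>_. discrete_topology UNIV) (carrier G)) U"
        "T = U \<inter> sub_char G ` {H. subgroup H G}"
      unfolding Sub_top_def openin_subtopology by blast
    have "sub_char G H \<in> U" using T U(2) by simp
    then obtain N where N: "finite {i \<in> carrier G. N i \<noteq> UNIV}"
        "sub_char G H \<in> Pi\<^sub>E (carrier G) N" "Pi\<^sub>E (carrier G) N \<subseteq> U"
      using U(1)[unfolded openin_product_topology_alt, rule_format, of "sub_char G H"] by auto
    \<comment> \<open>The finitely many restricted coordinates of the box serve as
      \<open>F\<close>.\<close>
    obtain H' where H': "H' \<in> S" "H' \<noteq> H"
        "H' \<inter> {i \<in> carrier G. N i \<noteq> UNIV} = H \<inter> {i \<in> carrier G. N i \<noteq> UNIV}"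
      using R[rule_format, OF N(1)] by blast
    have "sub_char G H' x \<in> N x" if "x \<in> carrier G" for x
    proof (cases "N x = UNIV")
      case False
      then have "x \<in> H' \<longleftrightarrow> x \<in> H" using H'(3) that by blast
      then show ?thesis using PiE_mem[OF N(2) that] that by (simp add: sub_char_def)
    qed simp
    then have "sub_char G H' \<in> Pi\<^sub>E (carrier G) N" by (auto simp: sub_char_def)
    moreover have "subgroup H' G" using H'(1) S by blast
    ultimately have "sub_char G H' \<in> T" using N(3) U(2) by auto
    moreover have "sub_char G H' \<noteq> sub_char G H"
      using H'(2) sub_char_eq_iff[OF \<open>subgroup H' G\<close> H] by simp
    ultimately show "\<exists>y. y \<noteq> sub_char G H \<and> y \<in> sub_char G ` S \<and> y \<in> T"
      using H'(1) by blast
  qed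
qed

lemma cb_deriv_Sub_top:
  assumes "S \<subseteq> {H. subgroup H G}"
  shows "cb_deriv (Sub_top G) (sub_char G ` S) = sub_char G ` accum_subgroups S"
proof -
  have "sub_char G H \<in> cb_deriv (Sub_top G) (sub_char G ` S) \<longleftrightarrow> H \<in> accum_subgroups S" if "H \<in> S" for H
    using derived_set_of_Sub_top_iff[OF _ assms, of H] that assms
    by (simp add: cb_deriv_def accum_subgroups_def subset_iff)
  moreover have "cb_deriv (Sub_top G) (sub_char G ` S) \<subseteq> sub_char G ` S"
    by (simp add: cb_deriv_def)
  moreover have "accum_subgroups S \<subseteq> S"
    by (auto simp: accum_subgroups_def)
  ultimately show ?thesis by blast
qed

lemma accum_subgroups_subset: "accum_subgroups S \<subseteq> S"
  by (auto simp: accum_subgroups_def)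

lemma accum_subgroups_funpow_subset: "(accum_subgroups ^^ m) S \<subseteq> S"
  by (induction m) (use accum_subgroups_subset in auto)

lemma cb_iter_Sub_top:
  "cb_iter (Sub_top G) m = sub_char G ` (accum_subgroups ^^ m) {H. subgroup H G}"
proof (induction m)
  case (Suc m)
  then show ?case
    using cb_deriv_Sub_top[OF accum_subgroups_funpow_subset[of m "{H. subgroup H G}"]]
    by (simp add: cb_iter_def)
qed (simp add: cb_iter_def topspace_Sub_top)

lemma cb_deriv_mono: "S \<subseteq> S' \<Longrightarrow> cb_deriv T S \<subseteq> cb_deriv T S'"
  unfolding cb_deriv_def using derived_set_of_mono by blast

text \<open>The derivative is monotone, so a set equal to its own derivative survives every finite
  stage.\<close>

lemma perfect_subset_cb_omega:
  assumes "K \<subseteq> topspace T" "cb_deriv T K = K"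
  shows "K \<subseteq> cb_omega T"
proof -
  have "K \<subseteq> cb_iter T m" for m
    by (induction m) (use assms cb_deriv_mono[of K _ T] in \<open>auto simp: cb_iter_def\<close>)
  then show ?thesis by (auto simp: cb_omega_def)
qed

text \<open>This serves to exclude finite ranks: stages after \<open>m\<close> are constant and
  stages before it are larger, so the intersection is already reached at \<open>m\<close>.\<close>

lemma cb_omega_eq_if_stationary:
  assumes "cb_iter T (Suc m) = cb_iter T m"
  shows "cb_omega T = cb_iter T m"
proof -
  have st: "cb_iter T (m + j) = cb_iter T m" for j
    by (induction j) (use assms in \<open>auto simp: cb_iter_def\<close>)
  have "antimono (cb_iter T)"
    by (rule decseq_SucI) (auto simp: cb_iter_def cb_deriv_def)
  then have "cb_iter T m \<subseteq> cb_iter T l" for l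
    using st[of "l - m"] antimonoD[of "cb_iter T" l m] by (cases "l \<le> m") auto
  then show ?thesis by (auto simp: cb_omega_def)
qed

subsection \<open>Leading positions of shift-invariant spaces\<close>

text \<open>Finitely supported residue maps stand for Laurent polynomials over the field with
  \<open>p\<close> elements. A nonempty such \<open>B\<close> is a submodule over the Laurent
  polynomials in \<open>t ^ s\<close>; the rule for \<open>u + c * v\<close> covers sums and scalar
  multiples at once.\<close>

definition shift_space :: "int \<Rightarrow> int \<Rightarrow> (int \<Rightarrow> int) set \<Rightarrow> bool" where
  "shift_space p s B \<longleftrightarrow>
     (\<forall>u\<in>B. \<forall>x. u x \<in> {0..<p}) \<and> (\<forall>u\<in>B. finite {x. u x \<noteq> 0}) \<and>
     (\<forall>u\<in>B. \<forall>v\<in>B. \<forall>c. (\<lambda>x. (u x + c * v x) mod p) \<in> B) \<and>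
     (\<forall>u\<in>B. \<forall>j. (\<lambda>x. u (x - s * j)) \<in> B)"

text \<open>The degrees of the nonzero Laurent polynomials in \<open>B\<close>.\<close>

definition lead_pos :: "(int \<Rightarrow> int) set \<Rightarrow> int set" where
  "lead_pos B = {q. \<exists>u\<in>B. u q \<noteq> 0 \<and> (\<forall>x>q. u x = 0)}"

lemma shift_space_Int: "shift_space p s B \<Longrightarrow> shift_space p s C \<Longrightarrow> shift_space p s (B \<inter> C)"
  by (auto simp: shift_space_def)

lemma lead_pos_shift:
  assumes "shift_space p s B" "q \<in> lead_pos B"
  shows "q + s * j \<in> lead_pos B"
proof -
  obtain u where u: "u \<in> B" "u q \<noteq> 0" "\<forall>x>q. u x = 0" using assms(2) by (auto simp: lead_pos_def)
  have "(\<lambda>x. u (x - s * j)) \<in> B" using assms(1) u(1) by (auto simp: shift_space_def)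
  then show ?thesis using u unfolding lead_pos_def
    by (intro CollectI bexI[of _ "\<lambda>x. u (x - s * j)"]) auto
qed

lemma lead_pos_shift_iff:
  assumes "shift_space p s B"
  shows "q + s * j \<in> lead_pos B \<longleftrightarrow> q \<in> lead_pos B"
  using lead_pos_shift[OF assms, of q j] lead_pos_shift[OF assms, of "q + s * j" "-j"] by auto

text \<open>Reduces the leading positions to their finitely many representatives in [0, s), from
  which generators are chosen and which the rank counts.\<close>

lemma lead_pos_mod_iff:
  assumes "shift_space p s B"
  shows "q mod s \<in> lead_pos B \<longleftrightarrow> q \<in> lead_pos B"
  using lead_pos_shift_iff[OF assms, of "q mod s" "q div s"] by simp

lemma finite_Collect_shift: "finite {x::int. P x} \<Longrightarrow> finite {x. P (x - k)}"
proof -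
  assume "finite {x. P x}"
  moreover have "{x. P (x - k)} = (\<lambda>x. x + k) ` {x. P x}" by (force simp: image_iff)
  ultimately show ?thesis by simp
qed

lemma finite_int_abs_bounded:
  fixes S :: "int set"
  assumes "finite S"
  shows "\<exists>D. \<forall>x\<in>S. \<bar>x\<bar> \<le> D"
  using bdd_above_finite[of "abs ` S"] assms by (auto simp: bdd_above_def)

lemma finite_finsupp:
  "finite {u :: int \<Rightarrow> int. (\<forall>x. u x \<in> {0..<p}) \<and> (\<forall>x. x \<notin> {a..<b} \<longrightarrow> u x = 0)}"
  by (rule finite_subset[OF _ finite_set_of_finite_funs[of "{a..<b}" "{0..<p}" 0]]) auto

text \<open>Division with remainder by \<open>D\<close> replaces an element of \<open>C\<close> supported on \<open>[0, \<infinity>)\<close> by one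
  supported on \<open>[0, s + W)\<close>; a translation moves any element into that half-line.\<close>

lemma shift_space_collapse:
  fixes p s W :: int
  assumes p: "Factorial_Ring.prime p" and s: "s > 0" and W: "W \<ge> 0"
    and C: "shift_space p s C" and D: "shift_space p s D"
    and g: "\<And>r. r \<in> {0..<s} \<Longrightarrow> r \<in> lead_pos C \<Longrightarrow>
             \<exists>u\<in>D. u r \<noteq> 0 \<and> (\<forall>x>r. u x = 0) \<and> (\<forall>x< - W. u x = 0)"
    and DC: "D \<subseteq> C"
    and E: "\<And>u. u \<in> C \<Longrightarrow> \<forall>x. x \<notin> {0..<s + W} \<longrightarrow> u x = 0 \<Longrightarrow> u \<in> D"
  shows "C \<subseteq> D"
proof -
  \<comment> \<open>Induction on the right end \<open>m\<close> of the support: each step cancels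
    the top entry using an element of \<open>D\<close>.\<close>
  have pos: "u \<in> D" if "u \<in> C" "\<forall>x. x \<notin> {0..<int m} \<longrightarrow> u x = 0" for m u
    using that
  proof (induction m arbitrary: u)
    case 0
    then show ?case by (intro E) auto
  next
    case (Suc m)
    define q where "q = int m"
    show ?case
    proof (cases "u q = 0")
      case True
      have "u x = 0" if "x \<notin> {0..<int m}" for x
        using Suc.prems(2) True that unfolding q_def by (cases "x = int m") auto
      then show ?thesis using Suc by blast
    next
      case False
      show ?thesis
      proof (cases "q < s + W")
        case True
        then have "{0..<int (Suc m)} \<subseteq> {0..<s + W}" by (auto simp: q_def)
        then show ?thesis using E[OF Suc.prems(1)] Suc.prems(2) by blast
      next
        case qW: False
        have "q \<in> lead_pos C"
          using Suc.prems False by (auto simp: lead_pos_def q_def intro!: bexI[of _ u])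
        then have "q mod s \<in> lead_pos C" using lead_pos_mod_iff[OF C] by simp
        then obtain d where d: "d \<in> D" "d (q mod s) \<noteq> 0" "\<forall>x>q mod s. d x = 0" "\<forall>x< - W. d x = 0"
          using g[of "q mod s"] s by auto
        \<comment> \<open>The translate of \<open>d\<close> by a multiple of \<open>s\<close> whose
          leading position is exactly \<open>q\<close>.\<close>
        define e where "e = (\<lambda>x. d (x - s * (q div s)))"
        have eD: "e \<in> D" using D d(1) by (auto simp: shift_space_def e_def)
        have qs: "q - s * (q div s) = q mod s" by (simp add: minus_mult_div_eq_mod)
        have eq0: "e q \<noteq> 0" using d(2) by (simp add: e_def qs)
        have etop: "e x = 0" if "x > q" for x
          using that d(3) qs by (auto simp: e_def)
        \<comment> \<open>Because q >= s + W, the translation exceeds \<open>W\<close>, so even the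
          part of \<open>d\<close> on [-W, 0) lands in the positive half-line and the remainder
          stays supported on [0, \<infinity>).\<close>
        have ebot: "e x = 0" if "x < 0" for x
        proof -
          have "s * (q div s) > q - s" using qs pos_mod_bound[OF s, of q] by linarith
          then have "x - s * (q div s) < -W" using that qW by linarith
          then show ?thesis using d(4) by (simp add: e_def)
        qed
        have "e q \<in> {0..<p}" using D eD by (auto simp: shift_space_def)
        \<comment> \<open>Primality makes the leading coefficient of \<open>e\<close> invertible, so
          a multiple of \<open>e\<close> cancels \<open>u q\<close>.\<close>
        then have "\<not> p dvd e q" using eq0 zdvd_not_zless[of "e q" p] by auto
        then have "coprime (e q) p" using p prime_imp_coprime[of p "e q"] by (simp add: coprime_commute)
        then obtain c where c: "[e q * c = 1] (mod p)" using cong_solve_coprime_int by blast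
        define v where "v = (\<lambda>x. (u x + (- (c * u q)) * e x) mod p)"
        have vC: "v \<in> C" using C Suc.prems(1) eD DC unfolding shift_space_def v_def by blast
        have "[u q + (- (c * u q)) * e q = u q + (- (u q)) * (e q * c)] (mod p)"
          by (simp add: algebra_simps)
        also have "[u q + (- (u q)) * (e q * c) = u q + (- (u q)) * 1] (mod p)"
          by (intro cong_add cong_mult c) auto
        finally have "v q = 0" by (simp add: v_def cong_def)
        have "v x = 0" if "x \<notin> {0..<int m}" for x
          using that \<open>v q = 0\<close> Suc.prems(2) etop[of x] ebot[of x]
          by (cases "x = q") (auto simp: v_def q_def)
        then have vD: "v \<in> D" using Suc.IH vC by blast
        have "u x \<in> {0..<p}" for x using C Suc.prems(1) by (auto simp: shift_space_def)
        then have "(v x + (c * u q) * e x) mod p = u x" for x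
          by (simp add: v_def mod_simps)
        then have "u = (\<lambda>x. (v x + (c * u q) * e x) mod p)" by auto
        moreover have "\<dots> \<in> D" using D vD eD unfolding shift_space_def by blast
        ultimately show ?thesis by simp
      qed
    qed
  qed
  show ?thesis
  proof
    fix u assume u: "u \<in> C"
    then have "finite {x. u x \<noteq> 0}" using C by (auto simp: shift_space_def)
    then obtain M where M: "\<And>x. u x \<noteq> 0 \<Longrightarrow> \<bar>x\<bar> \<le> M"
      using finite_int_abs_bounded[of "{x. u x \<noteq> 0}"] by blast
    define v where "v = (\<lambda>x. u (x - s * \<bar>M\<bar>))"
    have sM: "s * \<bar>M\<bar> \<ge> \<bar>M\<bar>" using s mult_right_mono[of 1 s "\<bar>M\<bar>"] by simp
    have "v \<in> C" using C u by (auto simp: shift_space_def v_def)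
    moreover have "v x = 0" if "x \<notin> {0..<int (nat (s * \<bar>M\<bar> + \<bar>M\<bar> + 1))}" for x
    proof (rule ccontr)
      assume "v x \<noteq> 0"
      then have "\<bar>x - s * \<bar>M\<bar>\<bar> \<le> M" using M by (auto simp: v_def)
      then show False using that sM by auto
    qed
    ultimately have "v \<in> D" using pos by blast
    then have "(\<lambda>x. v (x - s * (- \<bar>M\<bar>))) \<in> D" using D unfolding shift_space_def by blast
    then show "u \<in> D" by (simp add: v_def)
  qed
qed

text \<open>\<open>F\<close> consists of one element of \<open>B\<close> for each leading residue
  together with all possible remainders of division by them. The first kind forces the leading
  positions of \<open>B\<close> into \<open>C\<close>; when these coincide, both \<open>B\<close>
  and \<open>C\<close> collapse onto their intersection.\<close>

lemma shift_space_locally_determined: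
  fixes p s :: int
  assumes p: "Factorial_Ring.prime p" and s: "s > 0" and B: "shift_space p s B"
  obtains F where "finite F"
    and "\<And>C. shift_space p s C \<Longrightarrow> C \<inter> F = B \<inter> F \<Longrightarrow> lead_pos B \<subseteq> lead_pos C"
    and "\<And>C. shift_space p s C \<Longrightarrow> C \<inter> F = B \<inter> F \<Longrightarrow> lead_pos C = lead_pos B \<Longrightarrow> C = B"
proof -
  have "\<forall>r \<in> {0..<s} \<inter> lead_pos B. \<exists>u. u \<in> B \<and> u r \<noteq> 0 \<and> (\<forall>x>r. u x = 0)"
    by (auto simp: lead_pos_def)
  then obtain g where g: "\<And>r. r \<in> {0..<s} \<inter> lead_pos B \<Longrightarrow> g r \<in> B \<and> g r r \<noteq> 0 \<and> (\<forall>x>r. g r x = 0)"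
    by metis
  define Gs where "Gs = g ` ({0..<s} \<inter> lead_pos B)"
  have "finite (\<Union>u\<in>Gs. {x. u x \<noteq> 0})"
    using B g by (auto simp: Gs_def shift_space_def)
  then have "bdd_below (\<Union>u\<in>Gs. {x. u x \<noteq> 0})" by (rule bdd_below_finite)
  then obtain a where a: "\<And>u x. u \<in> Gs \<Longrightarrow> u x \<noteq> 0 \<Longrightarrow> a \<le> x" by (auto simp: bdd_below_def)
  define W where "W = \<bar>a\<bar>"
  have W: "u x = 0" if "u \<in> Gs" "x < -W" for u x
    using a[OF that(1), of x] that(2) by (force simp: W_def)
  \<comment> \<open>The possible remainders: finitely many, since both the window and the set of
    values are finite.\<close>
  define E where "E = {u :: int \<Rightarrow> int. (\<forall>x. u x \<in> {0..<p}) \<and> (\<forall>x. x \<notin> {0..<s+W} \<longrightarrow> u x = 0)}"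
  show ?thesis
  proof
    show "finite (Gs \<union> E)" unfolding E_def using finite_finsupp by (auto simp: Gs_def)
    fix C assume C: "shift_space p s C" and eq: "C \<inter> (Gs \<union> E) = B \<inter> (Gs \<union> E)"
    have "Gs \<subseteq> B" using g by (auto simp: Gs_def)
    then have GC: "Gs \<subseteq> C" using eq by blast
    show "lead_pos B \<subseteq> lead_pos C"
    proof
      fix q assume "q \<in> lead_pos B"
      then have *: "q mod s \<in> {0..<s} \<inter> lead_pos B" using lead_pos_mod_iff[OF B] s by simp
      then have "g (q mod s) \<in> C" using GC by (auto simp: Gs_def)
      then have "q mod s \<in> lead_pos C" using g[OF *] by (auto simp: lead_pos_def)
      then show "q \<in> lead_pos C" using lead_pos_mod_iff[OF C] by simp
    qed
    assume L: "lead_pos C = lead_pos B"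
    have D: "shift_space p s (B \<inter> C)" using B C by (rule shift_space_Int)
    have gD: "\<exists>u\<in>B \<inter> C. u r \<noteq> 0 \<and> (\<forall>x>r. u x = 0) \<and> (\<forall>x< - W. u x = 0)"
      if "r \<in> {0..<s}" "r \<in> lead_pos B" for r
      using g[of r] W[of "g r"] GC \<open>Gs \<subseteq> B\<close> that by (auto simp: Gs_def intro!: bexI[of _ "g r"])
    have W0: "W \<ge> 0" by (simp add: W_def)
    have inE: "u \<in> E" if "u \<in> N" "shift_space p s N" "\<forall>x. x \<notin> {0..<s + W} \<longrightarrow> u x = 0" for u N
      using that by (auto simp: E_def shift_space_def)
    \<comment> \<open>The intersection contains the chosen generators, and agreement on
      \<open>E\<close> puts every remainder from either space into both.\<close>
    have "C \<subseteq> B \<inter> C"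
      by (rule shift_space_collapse[OF p s W0 C D]) (use gD L inE[OF _ C] eq in auto)
    moreover have "B \<subseteq> B \<inter> C"
      by (rule shift_space_collapse[OF p s W0 B D]) (use gD L inE[OF _ B] eq in auto)
    ultimately show "C = B" by blast
  qed
qed

subsection \<open>Subgroups of the lamplighter group\<close>

definition lamp_subgroups :: "nat \<Rightarrow> nat \<Rightarrow> ((int \<Rightarrow> nat \<Rightarrow> int) \<times> int) set set" where
  "lamp_subgroups n p = {H. subgroup H (lamplighter n p)}"

definition base_subgroups :: "nat \<Rightarrow> nat \<Rightarrow> ((int \<Rightarrow> nat \<Rightarrow> int) \<times> int) set set" where
  "base_subgroups n p = {H \<in> lamp_subgroups n p. H \<subseteq> UNIV \<times> {0}}"

text \<open>Numbering the pairs (site, coordinate) lexicographically turns configurations into finitely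
  supported maps \<open>u\<close> on the integers; translation by \<open>k\<close> sites becomes translation by \<open>n * k\<close>.\<close>

definition unflatten :: "nat \<Rightarrow> (int \<Rightarrow> int) \<Rightarrow> int \<Rightarrow> nat \<Rightarrow> int" where
  "unflatten n u = (\<lambda>x i. if i < n then u (x * int n + int i) else 0)"

text \<open>The lamp part, i.e. the intersection of \<open>H\<close> with the base group, in
  flattened coordinates.\<close>

definition flat_base :: "nat \<Rightarrow> nat \<Rightarrow> ((int \<Rightarrow> nat \<Rightarrow> int) \<times> int) set \<Rightarrow> (int \<Rightarrow> int) set" where
  "flat_base n p H =
     {u. (\<forall>x. u x \<in> {0..<int p}) \<and> finite {x. u x \<noteq> 0} \<and> (unflatten n u, 0) \<in> H}"

text \<open>The positive generator of the projection of \<open>H\<close> to the integers; it is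
  meaningful only for subgroups not contained in the base group.\<close>

definition lamp_step :: "((int \<Rightarrow> nat \<Rightarrow> int) \<times> int) set \<Rightarrow> nat" where
  "lamp_step H = (LEAST k. 0 < k \<and> (\<exists>f. (f, int k) \<in> H))"

text \<open>The second summand counts the residues modulo \<open>n * k\<close> that are not leading positions, i.e. the rank
  of the base group modulo the lamp part of \<open>H\<close>, over the Laurent polynomials in \<open>t ^ k\<close>. The first summand
  makes the rank drop also when the lamp part stays the same and \<open>k\<close> is replaced by a proper divisor.\<close>

definition lamp_rank :: "nat \<Rightarrow> nat \<Rightarrow> ((int \<Rightarrow> nat \<Rightarrow> int) \<times> int) set \<Rightarrow> nat" where
  "lamp_rank n p H = lamp_step H + card ({0..<int (n * lamp_step H)} - lead_pos (flat_base n p H))"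

locale lamplighter_params =
  fixes n p :: nat
  assumes prime_p: "Factorial_Ring.prime p" and n_pos: "1 \<le> n"
begin

section \<open>The group law and the subgroup criterion in coordinates\<close>

lemma p_gt_1: "1 < int p"
  using prime_gt_1_nat[OF prime_p] by simp

lemma carrier_iff:
  "(f, k) \<in> carrier (lamplighter n p) \<longleftrightarrow>
     (\<forall>x i. 0 \<le> f x i \<and> f x i < int p) \<and> (\<forall>x i. n \<le> i \<longrightarrow> f x i = 0) \<and> finite {x. \<exists>i. f x i \<noteq> 0}"
  by (auto simp: lamplighter_def lamp_carrier_def)

lemma mult_lamplighter:
  "(f, k) \<otimes>\<^bsub>lamplighter n p\<^esub> (g, l) = (\<lambda>x i. (f x i + g (x - k) i) mod int p, k + l)"
  by (simp add: lamplighter_def)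

lemma one_lamplighter: "\<one>\<^bsub>lamplighter n p\<^esub> = (\<lambda>x i. 0, 0)"
  by (simp add: lamplighter_def)

lemma mod_eq_if_carrier: "(f, k) \<in> carrier (lamplighter n p) \<Longrightarrow> f x i mod int p = f x i"
  by (simp add: carrier_iff)

lemma mult_closed:
  assumes "(f, k) \<in> carrier (lamplighter n p)" "(g, l) \<in> carrier (lamplighter n p)"
  shows "(\<lambda>x i. (f x i + g (x - k) i) mod int p, k + l) \<in> carrier (lamplighter n p)"
proof -
  have "finite ({x. \<exists>i. f x i \<noteq> 0} \<union> {x. \<exists>i. g (x - k) i \<noteq> 0})"
    using assms finite_Collect_shift[of "\<lambda>x. \<exists>i. g x i \<noteq> 0" k] by (simp add: carrier_iff)
  then have "finite {x. \<exists>i. (f x i + g (x - k) i) mod int p \<noteq> 0}"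
    by (rule rev_finite_subset) auto
  then show ?thesis using assms p_gt_1 by (simp add: carrier_iff)
qed

lemma inv_closed:
  assumes "(f, k) \<in> carrier (lamplighter n p)"
  shows "(\<lambda>x i. (- f (x + k) i) mod int p, - k) \<in> carrier (lamplighter n p)"
proof -
  have "finite {x. \<exists>i. f (x + k) i \<noteq> 0}"
    using assms finite_Collect_shift[of "\<lambda>x. \<exists>i. f x i \<noteq> 0" "-k"] by (simp add: carrier_iff)
  then have "finite {x. \<exists>i. (- f (x + k) i) mod int p \<noteq> 0}"
    by (rule rev_finite_subset) (auto simp: zmod_zminus1_eq_if)
  then show ?thesis using assms p_gt_1 by (simp add: carrier_iff)
qed

lemma left_inverse:
  assumes "(f, k) \<in> carrier (lamplighter n p)"
  shows "(\<lambda>x i. (- f (x + k) i) mod int p, - k) \<otimes>\<^bsub>lamplighter n p\<^esub> (f, k) = \<one>\<^bsub>lamplighter n p\<^esub>"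
  by (simp add: mult_lamplighter one_lamplighter mod_simps)

lemma group_lamplighter: "group (lamplighter n p)"
proof (rule groupI)
  fix a b c
  assume "a \<in> carrier (lamplighter n p)" "b \<in> carrier (lamplighter n p)" "c \<in> carrier (lamplighter n p)"
  moreover obtain f k g l h m where "a = (f, k)" "b = (g, l)" "c = (h, m)"
    by (metis surj_pair)
  ultimately show "a \<otimes>\<^bsub>lamplighter n p\<^esub> b \<otimes>\<^bsub>lamplighter n p\<^esub> c
                 = a \<otimes>\<^bsub>lamplighter n p\<^esub> (b \<otimes>\<^bsub>lamplighter n p\<^esub> c)"
    by (simp add: mult_lamplighter mod_simps algebra_simps)
next
  fix a assume "a \<in> carrier (lamplighter n p)"
  moreover obtain f k where "a = (f, k)" by (metis surj_pair)
  ultimately show "\<one>\<^bsub>lamplighter n p\<^esub> \<otimes>\<^bsub>lamplighter n p\<^esub> a = a"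
      "\<exists>b\<in>carrier (lamplighter n p). b \<otimes>\<^bsub>lamplighter n p\<^esub> a = \<one>\<^bsub>lamplighter n p\<^esub>"
    using inv_closed[of f k] left_inverse[of f k]
    by (simp add: mult_lamplighter one_lamplighter mod_eq_if_carrier, blast)
next
  fix a b assume "a \<in> carrier (lamplighter n p)" "b \<in> carrier (lamplighter n p)"
  then show "a \<otimes>\<^bsub>lamplighter n p\<^esub> b \<in> carrier (lamplighter n p)"
    using mult_closed by (cases a; cases b) (auto simp: mult_lamplighter)
qed (use p_gt_1 in \<open>simp add: one_lamplighter carrier_iff\<close>)

lemma inv_lamplighter:
  assumes "(f, k) \<in> carrier (lamplighter n p)"
  shows "inv\<^bsub>lamplighter n p\<^esub> (f, k) = (\<lambda>x i. (- f (x + k) i) mod int p, - k)"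
  using group.inv_equality[OF group_lamplighter left_inverse[OF assms] assms inv_closed[OF assms]] .

lemma lamp_subgroups_iff:
  "H \<in> lamp_subgroups n p \<longleftrightarrow> H \<subseteq> carrier (lamplighter n p) \<and> (\<lambda>x i. 0, 0) \<in> H \<and>
     (\<forall>f k g l. (f, k) \<in> H \<longrightarrow> (g, l) \<in> H \<longrightarrow> (\<lambda>x i. (f x i + g (x - k) i) mod int p, k + l) \<in> H) \<and>
     (\<forall>f k. (f, k) \<in> H \<longrightarrow> (\<lambda>x i. (- f (x + k) i) mod int p, - k) \<in> H)"
  (is "_ \<longleftrightarrow> ?R")
proof
  assume "H \<in> lamp_subgroups n p"
  then have H: "subgroup H (lamplighter n p)" by (simp add: lamp_subgroups_def)
  show ?R
  proof (intro conjI allI impI)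
    show sub: "H \<subseteq> carrier (lamplighter n p)" by (rule subgroup.subset[OF H])
    show "(\<lambda>x i. 0, 0) \<in> H" using subgroup.one_closed[OF H] by (simp add: one_lamplighter)
    show "(\<lambda>x i. (f x i + g (x - k) i) mod int p, k + l) \<in> H" if "(f, k) \<in> H" "(g, l) \<in> H" for f k g l
      using subgroup.m_closed[OF H that] by (simp add: mult_lamplighter)
    show "(\<lambda>x i. (- f (x + k) i) mod int p, - k) \<in> H" if "(f, k) \<in> H" for f k
      using subgroup.m_inv_closed[OF H that] inv_lamplighter[of f k] sub that by auto
  qed
next
  assume R: ?R
  have "subgroup H (lamplighter n p)"
  proof (rule group.subgroupI[OF group_lamplighter])
    fix a assume "a \<in> H"
    then show "inv\<^bsub>lamplighter n p\<^esub> a \<in> H"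
      using R inv_lamplighter by (cases a) auto
  next
    fix a b assume "a \<in> H" "b \<in> H"
    then show "a \<otimes>\<^bsub>lamplighter n p\<^esub> b \<in> H"
      using R by (cases a; cases b) (simp add: mult_lamplighter)
  qed (use R in auto)
  then show "H \<in> lamp_subgroups n p" by (simp add: lamp_subgroups_def)
qed

text \<open>Since the base group is itself a subgroup, its subgroups are those of the whole group
  lying inside it; the argument can then stay in a single group.\<close>

lemma base_subgroups_eq: "{H. subgroup H (lamp_base n p)} = base_subgroups n p"
proof -
  let ?A = "{(f, k) \<in> lamp_carrier n p. k = 0}"
  have A: "subgroup ?A (lamplighter n p)"
  proof -
    have A_iff: "(f, k) \<in> ?A \<longleftrightarrow> (f, k) \<in> carrier (lamplighter n p) \<and> k = 0" for f k
      by (auto simp: lamplighter_def)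
    have "(\<lambda>x i. 0, 0) \<in> carrier (lamplighter n p)" using p_gt_1 by (simp add: carrier_iff)
    then have "?A \<in> lamp_subgroups n p"
      unfolding lamp_subgroups_iff A_iff
      using mult_closed[of _ 0 _ 0] inv_closed[of _ 0] by (auto simp: lamplighter_def)
    then show ?thesis by (simp add: lamp_subgroups_def)
  qed
  have "subgroup H (lamp_base n p) \<longleftrightarrow> subgroup H (lamplighter n p) \<and> H \<subseteq> ?A" for H
    unfolding lamp_base_def
    using group.incl_subgroup[OF group_lamplighter A, of H] group.subgroup_incl[OF group_lamplighter _ A, of H]
      subgroup.subset[of H "(lamplighter n p)\<lparr>carrier := ?A\<rparr>"] by auto
  moreover have "H \<subseteq> ?A \<longleftrightarrow> H \<subseteq> UNIV \<times> {0}" if "subgroup H (lamplighter n p)" for H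
    using subgroup.subset[OF that] by (auto simp: lamplighter_def)
  ultimately show ?thesis by (auto simp: base_subgroups_def lamp_subgroups_def)
qed

section \<open>Lamp configurations as finitely supported maps on the integers\<close>

lemma unflatten_in_carrier:
  assumes "\<forall>x. u x \<in> {0..<int p}" "finite {x. u x \<noteq> 0}"
  shows "(unflatten n u, k) \<in> carrier (lamplighter n p)"
proof -
  have "{x. \<exists>i. unflatten n u x i \<noteq> 0} \<subseteq> (\<lambda>q. q div int n) ` {x. u x \<noteq> 0}"
  proof
    fix x assume "x \<in> {x. \<exists>i. unflatten n u x i \<noteq> 0}"
    then obtain i where i: "i < n" "u (x * int n + int i) \<noteq> 0"
      by (auto simp: unflatten_def split: if_splits)
    moreover have "(x * int n + int i) div int n = x"
      using i n_pos by (simp add: div_add1_eq)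
    ultimately show "x \<in> (\<lambda>q. q div int n) ` {x. u x \<noteq> 0}"
      by (intro rev_image_eqI[of "x * int n + int i"]) simp_all
  qed
  then have "finite {x. \<exists>i. unflatten n u x i \<noteq> 0}"
    using assms(2) by (rule finite_subset[OF _ finite_imageI])
  then show ?thesis using assms(1) p_gt_1 by (auto simp: carrier_iff unflatten_def)
qed

lemma unflatten_surj:
  assumes "(f, k) \<in> carrier (lamplighter n p)"
  obtains u where "\<forall>x. u x \<in> {0..<int p}" "finite {x. u x \<noteq> 0}" "unflatten n u = f"
proof
  \<comment> \<open>Inverse of the numbering: position \<open>q\<close> is coordinate
    \<open>q mod n\<close> at site \<open>q div n\<close>.\<close>
  define u where "u = (\<lambda>q. f (q div int n) (nat (q mod int n)))"
  show "\<forall>x. u x \<in> {0..<int p}" using assms by (auto simp: u_def carrier_iff)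
  have "{q. u q \<noteq> 0} \<subseteq> (\<lambda>(x, i). x * int n + i) ` ({x. \<exists>i. f x i \<noteq> 0} \<times> {0..<int n})"
  proof
    fix q assume "q \<in> {q. u q \<noteq> 0}"
    then have "(q div int n, q mod int n) \<in> {x. \<exists>i. f x i \<noteq> 0} \<times> {0..<int n}"
      using n_pos by (auto simp: u_def)
    then show "q \<in> (\<lambda>(x, i). x * int n + i) ` ({x. \<exists>i. f x i \<noteq> 0} \<times> {0..<int n})"
      by (rule rev_image_eqI) simp
  qed
  then show "finite {x. u x \<noteq> 0}"
    by (rule finite_subset[OF _ finite_imageI]) (use assms in \<open>simp add: carrier_iff\<close>)
  have "unflatten n u x i = f x i" for x i
  proof (cases "i < n")
    case True
    then have "(x * int n + int i) div int n = x" "(x * int n + int i) mod int n = int i"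
      by (simp_all add: div_add1_eq)
    then show ?thesis using True by (simp add: unflatten_def u_def)
  qed (use assms in \<open>simp add: unflatten_def carrier_iff\<close>)
  then show "unflatten n u = f" by blast
qed

lemma unflatten_shift: "unflatten n (\<lambda>x. u (x - int n * j)) = (\<lambda>x. unflatten n u (x - j))"
  by (auto simp: unflatten_def fun_eq_iff algebra_simps)

lemma unflatten_lincomb:
  "unflatten n (\<lambda>x. (u x + c * v x) mod int p)
     = (\<lambda>x i. (unflatten n u x i + (c * unflatten n v x i) mod int p) mod int p)"
  by (auto simp: unflatten_def fun_eq_iff mod_simps)

section \<open>The lamp part of a subgroup as a module\<close>

lemma lamp_subgroup_mult:
  assumes "H \<in> lamp_subgroups n p" "(f, k) \<in> H" "(g, l) \<in> H"
  shows "(\<lambda>x i. (f x i + g (x - k) i) mod int p, k + l) \<in> H"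
  using assms unfolding lamp_subgroups_iff by blast

lemma lamp_subgroup_inv:
  assumes "H \<in> lamp_subgroups n p" "(f, k) \<in> H"
  shows "(\<lambda>x i. (- f (x + k) i) mod int p, - k) \<in> H"
  using assms unfolding lamp_subgroups_iff by blast

lemma lamp_subgroup_carrier:
  assumes "H \<in> lamp_subgroups n p" "a \<in> H"
  shows "a \<in> carrier (lamplighter n p)"
  using assms unfolding lamp_subgroups_iff by blast

lemma lamp_subgroup_smult:
  assumes H: "H \<in> lamp_subgroups n p" and f: "(f, 0) \<in> H"
  shows "(\<lambda>x i. (c * f x i) mod int p, 0) \<in> H"
proof -
  have *: "(\<lambda>x i. (int m * f x i) mod int p, 0) \<in> H" for m
  proof (induction m)
    case 0
    then show ?case using H by (simp add: lamp_subgroups_iff)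
  next
    case (Suc m)
    show ?case using lamp_subgroup_mult[OF H f Suc] by (simp add: mod_simps algebra_simps)
  qed
  have "int (nat (c mod int p)) = c mod int p" using p_gt_1 by simp
  then show ?thesis using *[of "nat (c mod int p)"] by (simp add: mod_simps)
qed

text \<open>Conjugation by \<open>(v, l)\<close> translates \<open>f\<close> by \<open>l\<close>;
  the lamps of \<open>v\<close> cancel because the base group is abelian.\<close>

lemma lamp_subgroup_shift:
  assumes H: "H \<in> lamp_subgroups n p" and v: "(v, l) \<in> H" and f: "(f, 0) \<in> H"
  shows "(\<lambda>x. f (x - l), 0) \<in> H"
proof -
  have "f x i mod int p = f x i" for x i
    using mod_eq_if_carrier[OF lamp_subgroup_carrier[OF H f]] .
  then show ?thesis
    using lamp_subgroup_mult[OF H lamp_subgroup_mult[OF H v f] lamp_subgroup_inv[OF H v]]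
    by (simp add: mod_simps)
qed

lemma lamp_subgroup_multiple:
  assumes H: "H \<in> lamp_subgroups n p" and v: "(v, k) \<in> H"
  shows "\<exists>w. (w, k * j) \<in> H"
proof -
  have *: "\<exists>w. (w, k * int m) \<in> H" for m
  proof (induction m)
    case 0
    then show ?case using H by (auto simp: lamp_subgroups_iff)
  next
    case (Suc m)
    then show ?case using lamp_subgroup_mult[OF H v] by (fastforce simp: algebra_simps)
  qed
  show ?thesis
  proof (cases "j \<ge> 0")
    case True
    then show ?thesis using *[of "nat j"] by simp
  next
    case False
    then show ?thesis using *[of "nat (- j)"] lamp_subgroup_inv[OF H] by fastforce
  qed
qed

text \<open>Any element of \<open>H\<close> over \<open>k\<close> will do, and \<open>k\<close> may
  be a proper multiple of \<open>lamp_step H\<close>. This allows a subgroup and its neighbours to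
  be compared as modules over the same ring.\<close>

lemma shift_space_flat_base:
  assumes H: "H \<in> lamp_subgroups n p" and v: "(v, int k) \<in> H"
  shows "shift_space (int p) (int (n * k)) (flat_base n p H)"
  unfolding shift_space_def
proof (intro conjI ballI allI)
  fix u w c assume u: "u \<in> flat_base n p H" and w: "w \<in> flat_base n p H"
  have "finite ({x. u x \<noteq> 0} \<union> {x. w x \<noteq> 0})" using u w by (simp add: flat_base_def)
  then have "finite {x. (u x + c * w x) mod int p \<noteq> 0}" by (rule rev_finite_subset) auto
  moreover have "(unflatten n (\<lambda>x. (u x + c * w x) mod int p), 0) \<in> H"
    using u w lamp_subgroup_mult[OF H, of "unflatten n u" 0 _ 0] lamp_subgroup_smult[OF H, of "unflatten n w" c]
    by (simp add: flat_base_def unflatten_lincomb)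
  ultimately show "(\<lambda>x. (u x + c * w x) mod int p) \<in> flat_base n p H"
    using p_gt_1 by (simp add: flat_base_def)
next
  fix u j assume u: "u \<in> flat_base n p H"
  obtain w where w: "(w, int k * j) \<in> H" using lamp_subgroup_multiple[OF H v] by blast
  have "(\<lambda>x. unflatten n u (x - int k * j), 0) \<in> H"
    using lamp_subgroup_shift[OF H w] u by (simp add: flat_base_def)
  moreover have "unflatten n (\<lambda>x. u (x - int (n * k) * j)) = (\<lambda>x. unflatten n u (x - int k * j))"
    using unflatten_shift[of u "int k * j"] by (simp add: mult.assoc)
  ultimately show "(\<lambda>x. u (x - int (n * k) * j)) \<in> flat_base n p H"
    using u finite_Collect_shift[of "\<lambda>x. u x \<noteq> 0" "int (n * k) * j"] by (simp add: flat_base_def)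
qed (auto simp: flat_base_def)

section \<open>Subgroups outside the base group and the drop of the rank\<close>

lemma lamp_step_le: "0 < k \<Longrightarrow> (f, int k) \<in> H \<Longrightarrow> lamp_step H \<le> k"
  unfolding lamp_step_def by (rule Least_le) auto

lemma lamp_step_attained:
  assumes H: "H \<in> lamp_subgroups n p" "H \<notin> base_subgroups n p"
  shows "0 < lamp_step H \<and> (\<exists>v. (v, int (lamp_step H)) \<in> H)"
proof -
  obtain f l where f: "(f, l) \<in> H" "l \<noteq> 0"
    using H by (auto simp: base_subgroups_def)
  have "\<exists>g. (g, \<bar>l\<bar>) \<in> H"
    using f lamp_subgroup_inv[OF H(1) f(1)] by (cases "l \<ge> 0") auto
  then have "0 < nat \<bar>l\<bar> \<and> (\<exists>g. (g, int (nat \<bar>l\<bar>)) \<in> H)" using f by simp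
  then show ?thesis unfolding lamp_step_def by (rule LeastI)
qed

text \<open>Dividing an element of \<open>H'\<close> repeatedly by the common element
  \<open>g\<close> leads down to the shared lamp part. Only the minimal step of \<open>H'\<close>
  enters, so exchanging the roles gives the other inclusion whenever both steps are
  \<open>k\<close>.\<close>

lemma lamp_subgroup_determined:
  assumes H: "H \<in> lamp_subgroups n p" and H': "H' \<in> lamp_subgroups n p"
    and step: "lamp_step H' = k" and k: "0 < k"
    and g: "(g, int k) \<in> H" "(g, int k) \<in> H'"
    and B: "flat_base n p H' = flat_base n p H"
  shows "H' \<subseteq> H"
proof -
  have nonneg: "(f, int m) \<in> H" if "(f, int m) \<in> H'" for f m
    using that
  proof (induction m arbitrary: f rule: less_induct)
    case (less m)
    have f_mod: "f x i mod int p = f x i" for x i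
      using mod_eq_if_carrier[OF lamp_subgroup_carrier[OF H' less.prems]] .
    consider "m = 0" | "0 < m" "m < k" | "k \<le> m" by linarith
    then show ?case
    proof cases
      case 1
      obtain u where u: "\<forall>x. u x \<in> {0..<int p}" "finite {x. u x \<noteq> 0}" "unflatten n u = f"
        using unflatten_surj[OF lamp_subgroup_carrier[OF H' less.prems]] .
      then have "u \<in> flat_base n p H'" using less.prems 1 by (simp add: flat_base_def)
      then show ?thesis using u 1 unfolding B by (simp add: flat_base_def)
    next
      \<comment> \<open>Excluded by minimality: \<open>H'\<close> has no element over a position
        strictly between 0 and \<open>k\<close>.\<close>
      case 2
      then show ?thesis using lamp_step_le[OF _ less.prems] step by simp
    next
      case 3
      have "(\<lambda>x i. (f x i + (- g (x - int m + int k) i) mod int p) mod int p, int (m - k)) \<in> H'"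
        using lamp_subgroup_mult[OF H' less.prems lamp_subgroup_inv[OF H' g(2)]] 3
        by (simp add: of_nat_diff)
      then have "(\<lambda>x i. (f x i + (- g (x - int m + int k) i) mod int p) mod int p, int (m - k)) \<in> H"
        using less.IH[of "m - k"] 3 k by simp
      from lamp_subgroup_mult[OF H this g(1)] show ?thesis
        using 3 by (simp add: mod_simps of_nat_diff f_mod algebra_simps)
    qed
  qed
  show ?thesis
  proof
    fix a assume "a \<in> H'"
    obtain f l where a: "a = (f, l)" by (metis surj_pair)
    show "a \<in> H"
    proof (cases "l \<ge> 0")
      case True
      then show ?thesis using nonneg[of f "nat l"] \<open>a \<in> H'\<close> a by simp
    next
      case False
      have f_mod: "f x i mod int p = f x i" for x i
        using mod_eq_if_carrier[of f l] lamp_subgroup_carrier[OF H' \<open>a \<in> H'\<close>] a by blast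
      have "(\<lambda>x i. (- f (x + l) i) mod int p, - l) \<in> H"
        using nonneg[of _ "nat (- l)"] lamp_subgroup_inv[OF H', of f l] \<open>a \<in> H'\<close> a False by simp
      from lamp_subgroup_inv[OF H this] show ?thesis by (simp add: mod_simps f_mod a)
    qed
  qed
qed

text \<open>\<open>F\<close> contains an element \<open>g\<close> over the step of \<open>H\<close>
  and a finite set determining the lamp part relative to its leading positions. A neighbour then
  contains \<open>g\<close>, has step at most \<open>k\<close> and at least the leading positions of
  \<open>H\<close>, so neither summand of the rank can grow. Keeping \<open>F\<close> inside the
  carrier is what makes the later counting possible.\<close>

lemma lamp_rank_drops_nearby:
  assumes H: "H \<in> lamp_subgroups n p" "H \<notin> base_subgroups n p"
  shows "\<exists>F. finite F \<and> F \<subseteq> carrier (lamplighter n p) \<and>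
           (\<forall>H'\<in>lamp_subgroups n p. H' \<inter> F = H \<inter> F \<longrightarrow>
              H' = H \<or> H' \<notin> base_subgroups n p \<and> lamp_rank n p H' < lamp_rank n p H)"
proof -
  define k where "k = lamp_step H"
  obtain g where k: "0 < k" and g: "(g, int k) \<in> H"
    using lamp_step_attained[OF H] by (auto simp: k_def)
  define s where "s = int (n * k)"
  have s: "0 < s" using k n_pos by (simp add: s_def)
  define B where "B = flat_base n p H"
  have B: "shift_space (int p) s B"
    using shift_space_flat_base[OF H(1) g] by (simp add: B_def s_def)
  have pp: "Factorial_Ring.prime (int p)" using prime_p by simp
  obtain F0 where F0: "finite F0"
    "\<And>C. shift_space (int p) s C \<Longrightarrow> C \<inter> F0 = B \<inter> F0 \<Longrightarrow> lead_pos B \<subseteq> lead_pos C"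
    "\<And>C. shift_space (int p) s C \<Longrightarrow> C \<inter> F0 = B \<inter> F0 \<Longrightarrow> lead_pos C = lead_pos B \<Longrightarrow> C = B"
    using shift_space_locally_determined[OF pp s B] by metis
  define F1 where "F1 = (\<lambda>u. (unflatten n u, 0 :: int)) `
    (F0 \<inter> {u. (\<forall>x. u x \<in> {0..<int p}) \<and> finite {x. u x \<noteq> 0}})"
  define F where "F = insert (g, int k) F1"
  have "finite F" using F0(1) by (simp add: F_def F1_def)
  moreover have "F \<subseteq> carrier (lamplighter n p)"
    using unflatten_in_carrier lamp_subgroup_carrier[OF H(1) g] by (auto simp: F_def F1_def)
  moreover have "H' = H \<or> H' \<notin> base_subgroups n p \<and> lamp_rank n p H' < lamp_rank n p H"
    if H': "H' \<in> lamp_subgroups n p" and eq: "H' \<inter> F = H \<inter> F" for H'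
  proof -
    have g': "(g, int k) \<in> H'" using g eq by (auto simp: F_def)
    then have nb: "H' \<notin> base_subgroups n p" using k by (auto simp: base_subgroups_def)
    define k' where "k' = lamp_step H'"
    have k'k: "k' \<le> k" unfolding k'_def by (rule lamp_step_le[OF k g'])
    define B' where "B' = flat_base n p H'"
    \<comment> \<open>The modulus \<open>s\<close> belongs to \<open>H\<close>, not to
      \<open>H'\<close>; it is admissible for \<open>H'\<close> because \<open>g\<close> lies in
      \<open>H'\<close> too.\<close>
    have B': "shift_space (int p) s B'"
      using shift_space_flat_base[OF H' g'] by (simp add: B'_def s_def)
    have "(unflatten n u, 0) \<in> H' \<longleftrightarrow> (unflatten n u, 0) \<in> H"
      if "u \<in> F0" "\<forall>x. u x \<in> {0..<int p}" "finite {x. u x \<noteq> 0}" for u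
    proof -
      have "(unflatten n u, 0) \<in> F" using that by (auto simp: F_def F1_def)
      then show ?thesis using eq by blast
    qed
    then have BF: "B' \<inter> F0 = B \<inter> F0" unfolding B_def B'_def flat_base_def by blast
    have LL: "lead_pos B \<subseteq> lead_pos B'" using F0(2)[OF B' BF] .
    have "int (n * k') \<le> s" unfolding s_def using k'k by (intro of_nat_mono mult_le_mono2)
    then have sub: "{0..<int (n * k')} - lead_pos B' \<subseteq> {0..<s} - lead_pos B'" by auto
    have rH: "lamp_rank n p H = k + card ({0..<s} - lead_pos B)"
      by (simp add: lamp_rank_def k_def s_def B_def)
    have rH': "lamp_rank n p H' = k' + card ({0..<int (n * k')} - lead_pos B')"
      by (simp add: lamp_rank_def k'_def B'_def)
    show ?thesis
    proof (cases "lead_pos B' = lead_pos B")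
      case True
      then have BB: "B' = B" using F0(3)[OF B' BF] by blast
      show ?thesis
      proof (cases "k' = k")
        case True
        have fb: "flat_base n p H' = flat_base n p H" using BB by (simp add: B_def B'_def)
        have "H' \<subseteq> H"
          using lamp_subgroup_determined[OF H(1) H' _ k g g' fb] True by (simp add: k'_def)
        moreover have "H \<subseteq> H'"
          using lamp_subgroup_determined[OF H' H(1) _ k g' g fb[symmetric]] by (simp add: k_def)
        ultimately show ?thesis by blast
      next
        case False
        \<comment> \<open>Equal lamp parts but a smaller step: the second summand does not grow
          while the first one drops.\<close>
        have "card ({0..<int (n * k')} - lead_pos B') \<le> card ({0..<s} - lead_pos B)"
          using sub unfolding BB by (intro card_mono) auto
        then show ?thesis using nb False k'k rH rH' by simp
      qed
    next
      case False
      then obtain q where "q \<in> lead_pos B'" "q \<notin> lead_pos B" using LL by blast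
      \<comment> \<open>A new leading position yields a new residue, so the second summand drops
        strictly.\<close>
      then have "q mod s \<in> lead_pos B'" "q mod s \<notin> lead_pos B"
        using lead_pos_mod_iff[OF B] lead_pos_mod_iff[OF B'] by auto
      moreover have "q mod s \<in> {0..<s}" using s by simp
      ultimately have "{0..<int (n * k')} - lead_pos B' \<subset> {0..<s} - lead_pos B"
        using sub LL by blast
      then have "card ({0..<int (n * k')} - lead_pos B') < card ({0..<s} - lead_pos B)"
        by (intro psubset_card_mono) auto
      then show ?thesis using nb k'k rH rH' by simp
    qed
  qed
  ultimately show ?thesis by blast
qed

end

subsection \<open>Neighbourhoods of subgroups of the base group\<close>

lemma uncountable_UNIV_nat_set: "uncountable (UNIV :: nat set set)"
proof
  assume "countable (UNIV :: nat set set)"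
  then obtain f :: "nat \<Rightarrow> nat set" where "range f = UNIV"
    by (metis uncountable_def UNIV_not_empty)
  then show False using Cantors_theorem[of "UNIV :: nat set"] by auto
qed

context lamplighter_params
begin

section \<open>Countability outside the base group, uncountability inside it\<close>

lemma countable_carrier: "countable (carrier (lamplighter n p))"
proof -
  define U where "U D = {u :: int \<Rightarrow> int. (\<forall>x. u x \<in> {0..<int p}) \<and> (\<forall>x. x \<notin> {- int D..<int D} \<longrightarrow> u x = 0)}" for D
  have "countable (\<Union>D. U D)"
    unfolding U_def by (intro countable_UN countable_finite finite_finsupp countableI_type)
  then have "countable ((\<lambda>(u, k). (unflatten n u, k)) ` ((\<Union>D. U D) \<times> (UNIV :: int set)))" by simp
  moreover have "carrier (lamplighter n p) \<subseteq> (\<lambda>(u, k). (unflatten n u, k)) ` ((\<Union>D. U D) \<times> UNIV)"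
  proof
    fix a assume a: "a \<in> carrier (lamplighter n p)"
    obtain f k where fk: "a = (f, k)" by (metis surj_pair)
    obtain u where u: "\<forall>x. u x \<in> {0..<int p}" "finite {x. u x \<noteq> 0}" "unflatten n u = f"
      using unflatten_surj a fk by blast
    obtain D where D: "\<And>x. u x \<noteq> 0 \<Longrightarrow> \<bar>x\<bar> \<le> D"
      using finite_int_abs_bounded[OF u(2)] by blast
    have "u x = 0" if "x \<notin> {- int (nat (D + 1))..<int (nat (D + 1))}" for x
      using D[of x] that by (cases "u x = 0") auto
    then have "u \<in> U (nat (D + 1))" using u(1) unfolding U_def by blast
    then show "a \<in> (\<lambda>(u, k). (unflatten n u, k)) ` ((\<Union>D. U D) \<times> UNIV)"
      using fk u(3) by (intro rev_image_eqI[of "(u, k)"]) auto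
  qed
  ultimately show ?thesis by (rule countable_subset[rotated])
qed

text \<open>\<open>H\<close> is recovered from its rank, its finite set \<open>\<Phi> H\<close> and
  its trace on that set: any other subgroup with this trace has strictly smaller rank. Only
  countably many such codes exist.\<close>

lemma countable_nonbase: "countable (lamp_subgroups n p - base_subgroups n p)"
proof -
  let ?C = "lamp_subgroups n p - base_subgroups n p"
  obtain \<Phi> where \<Phi>: "\<And>H. H \<in> ?C \<Longrightarrow> finite (\<Phi> H) \<and> \<Phi> H \<subseteq> carrier (lamplighter n p) \<and>
           (\<forall>H'\<in>lamp_subgroups n p. H' \<inter> \<Phi> H = H \<inter> \<Phi> H \<longrightarrow>
              H' = H \<or> H' \<notin> base_subgroups n p \<and> lamp_rank n p H' < lamp_rank n p H)"
    using lamp_rank_drops_nearby by (metis DiffE)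
  define code where "code H = (lamp_rank n p H, \<Phi> H, H \<inter> \<Phi> H)" for H
  have "inj_on code ?C"
  proof (rule inj_onI)
    fix H H' assume H: "H \<in> ?C" "H' \<in> ?C" and eq: "code H = code H'"
    from eq have "\<Phi> H = \<Phi> H' \<and> H \<inter> \<Phi> H = H' \<inter> \<Phi> H' \<and> lamp_rank n p H = lamp_rank n p H'"
      unfolding code_def prod.inject by blast
    then have "H' \<inter> \<Phi> H = H \<inter> \<Phi> H" "lamp_rank n p H' = lamp_rank n p H" by metis+
    moreover from this have "H' = H \<or> lamp_rank n p H' < lamp_rank n p H" using \<Phi>[OF H(1)] H(2) by blast
    ultimately show "H = H'" by simp
  qed
  moreover have "countable (code ` ?C)"
  proof (rule countable_subset)
    let ?P = "{F. finite F \<and> F \<subseteq> carrier (lamplighter n p)}"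
    show "code ` ?C \<subseteq> (UNIV :: nat set) \<times> ?P \<times> ?P"
      using \<Phi> by (auto simp: code_def)
    have "countable ?P"
      using countable_Collect_finite_subset[OF countable_carrier] .
    then show "countable ((UNIV :: nat set) \<times> ?P \<times> ?P)" by simp
  qed
  ultimately show ?thesis using countable_image_inj_on by blast
qed

text \<open>Far from the supports of the finitely many constraints, the sites where the lamps of a
  subgroup may be lit can be prescribed arbitrarily.\<close>

lemma uncountable_base_nbhd:
  assumes H: "H \<in> base_subgroups n p" and F: "finite F"
  shows "uncountable {H' \<in> base_subgroups n p. H' \<inter> F = H \<inter> F}"
proof -
  have Hs: "H \<in> lamp_subgroups n p" and H0: "\<And>f k. (f, k) \<in> H \<Longrightarrow> k = 0"
    using H by (auto simp: base_subgroups_def)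
  define Y where "Y = (\<Union>(f, k) \<in> F \<inter> carrier (lamplighter n p). {x. \<exists>i. f x i \<noteq> 0})"
  have "finite Y" using F unfolding Y_def by (intro finite_UN_I) (auto simp: carrier_iff)
  from finite_int_abs_bounded[OF this] obtain D where D: "\<forall>x\<in>Y. \<bar>x\<bar> \<le> D" by (elim exE)
  define cut where "cut f = (\<lambda>x i. if \<bar>x\<bar> \<le> D then f x i else (0::int))" for f :: "int \<Rightarrow> nat \<Rightarrow> int"
  \<comment> \<open>Distinct sites beyond all lamps of \<open>F\<close>; the absolute value is taken
    because the bound \<open>D\<close> may be negative when \<open>Y\<close> is empty.\<close>
  define far where "far m = \<bar>D\<bar> + 1 + int m" for m
  \<comment> \<open>On [-D, D] the lamps are constrained by \<open>H\<close>; beyond it they are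
    free at the sites coded by \<open>S\<close> and off elsewhere.\<close>
  define T where "T S = {(f, k). (f, k) \<in> carrier (lamplighter n p) \<and> k = 0 \<and> (cut f, 0) \<in> H \<and>
      (\<forall>x i. \<bar>x\<bar> > D \<longrightarrow> f x i \<noteq> 0 \<longrightarrow> x \<in> far ` S)}" for S
  have T_iff: "(f, k) \<in> T S \<longleftrightarrow> (f, k) \<in> carrier (lamplighter n p) \<and> k = 0 \<and> (cut f, 0) \<in> H \<and>
      (\<forall>x i. \<bar>x\<bar> > D \<longrightarrow> f x i \<noteq> 0 \<longrightarrow> x \<in> far ` S)" for f k S
    by (simp add: T_def)
  have zero: "(\<lambda>x i. 0, 0) \<in> H" using Hs by (simp add: lamp_subgroups_iff)
  have T_lamp: "T S \<in> lamp_subgroups n p" for S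
    unfolding lamp_subgroups_iff
  proof (intro conjI allI impI)
    show "T S \<subseteq> carrier (lamplighter n p)" by (auto simp: T_def)
    have "cut (\<lambda>x i. 0) = (\<lambda>x i. 0)" by (simp add: cut_def)
    then show "(\<lambda>x i. 0, 0) \<in> T S"
      using zero lamp_subgroup_carrier[OF Hs] by (simp add: T_iff)
  next
    fix f k g l assume f: "(f, k) \<in> T S" and g: "(g, l) \<in> T S"
    then have k: "k = 0" "l = 0" by (auto simp: T_iff)
    have "cut (\<lambda>x i. (f x i + g x i) mod int p) = (\<lambda>x i. (cut f x i + cut g (x - 0) i) mod int p)"
      by (auto simp: cut_def fun_eq_iff)
    then have "(cut (\<lambda>x i. (f x i + g x i) mod int p), 0) \<in> H"
      using lamp_subgroup_mult[OF Hs, of "cut f" 0 "cut g" 0] f g by (simp add: T_iff)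
    moreover have "x \<in> far ` S" if x: "\<bar>x\<bar> > D" and nz: "(f x i + g x i) mod int p \<noteq> 0" for x i
    proof -
      have "f x i \<noteq> 0 \<or> g x i \<noteq> 0" using nz by auto
      then show ?thesis using f g x unfolding T_iff by blast
    qed
    moreover have "(\<lambda>x i. (f x i + g x i) mod int p, 0) \<in> carrier (lamplighter n p)"
      using f g mult_closed[of f 0 g 0] by (auto simp: T_iff)
    ultimately show "(\<lambda>x i. (f x i + g (x - k) i) mod int p, k + l) \<in> T S"
      unfolding T_iff k diff_zero add_0_right by blast
  next
    fix f k assume f: "(f, k) \<in> T S"
    then have k: "k = 0" by (auto simp: T_iff)
    have "cut (\<lambda>x i. (- f x i) mod int p) = (\<lambda>x i. (- cut f (x + 0) i) mod int p)"
      by (auto simp: cut_def fun_eq_iff)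
    then have "(cut (\<lambda>x i. (- f x i) mod int p), 0) \<in> H"
      using lamp_subgroup_inv[OF Hs, of "cut f" 0] f by (simp add: T_iff)
    moreover have "x \<in> far ` S" if x: "\<bar>x\<bar> > D" and nz: "(- f x i) mod int p \<noteq> 0" for x i
    proof -
      have "f x i \<noteq> 0" using nz by auto
      then show ?thesis using f x unfolding T_iff by blast
    qed
    moreover have "(\<lambda>x i. (- f x i) mod int p, 0) \<in> carrier (lamplighter n p)"
      using f inv_closed[of f 0] by (auto simp: T_iff)
    ultimately show "(\<lambda>x i. (- f (x + k) i) mod int p, - k) \<in> T S"
      unfolding T_iff k minus_zero add_0_right by blast
  qed
  have "T S \<in> base_subgroups n p" for S
    using T_lamp by (auto simp: base_subgroups_def T_def)
  moreover have "T S \<inter> F = H \<inter> F" for S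
  proof -
    have "(f, k) \<in> T S \<longleftrightarrow> (f, k) \<in> H" if fF: "(f, k) \<in> F" for f k
    proof (cases "(f, k) \<in> carrier (lamplighter n p)")
      case True
      have f0: "f x i = 0" if "\<bar>x\<bar> > D" for x i
      proof (rule ccontr)
        assume "f x i \<noteq> 0"
        then have "x \<in> Y" using True fF unfolding Y_def by blast
        then show False using D that by auto
      qed
      then have "cut f = f" by (auto simp: cut_def fun_eq_iff)
      then show ?thesis using True H0[of f k] f0 by (auto simp: T_iff)
    next
      case False
      then show ?thesis using lamp_subgroup_carrier[OF Hs] by (auto simp: T_iff)
    qed
    then show ?thesis by auto
  qed
  ultimately have sub: "range T \<subseteq> {H' \<in> base_subgroups n p. H' \<inter> F = H \<inter> F}" by blast
  have "inj T"
  proof (rule injI)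
    \<comment> \<open>\<open>S\<close> is read off from \<open>T S\<close> by testing a single lamp
      at each site \<open>far m\<close>.\<close>
    have mem: "m \<in> S \<longleftrightarrow> (\<lambda>x i. if x = far m \<and> i = 0 then 1 else 0, 0) \<in> T S" for m S
    proof -
      let ?e = "\<lambda>x i. if x = far m \<and> i = (0::nat) then 1 else (0::int)"
      have "{x. \<exists>i. ?e x i \<noteq> 0} = {far m}" by auto
      then have "(?e, 0) \<in> carrier (lamplighter n p)"
        using p_gt_1 n_pos by (simp add: carrier_iff)
      moreover have "D < \<bar>far m\<bar>" by (simp add: far_def)
      moreover from this have "cut ?e = (\<lambda>x i. 0)" by (auto simp: cut_def fun_eq_iff)
      moreover have "far m \<in> far ` S \<longleftrightarrow> m \<in> S" by (auto simp: far_def)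
      ultimately show ?thesis using zero by (auto simp: T_iff split: if_splits)
    qed
    fix S S' assume "T S = T S'"
    then show "S = S'" using mem by blast
  qed
  then have "uncountable (range T)"
    using countable_image_inj_on[of T UNIV] uncountable_UNIV_nat_set by auto
  then show ?thesis using countable_subset[OF sub] by auto
qed

end

subsection \<open>Subgroups of large finite rank\<close>

text \<open>The lamp part is the sum over the residues \<open>r\<close> modulo \<open>k\<close> of the cyclic submodules generated by
  \<open>1 - t ^ (k * N r)\<close> at site \<open>r\<close>, with \<open>h\<close> as the cofactors; \<open>N r = 0\<close> gives the zero summand.\<close>

definition periodic_lamps :: "nat \<Rightarrow> nat \<Rightarrow> int \<Rightarrow> (int \<Rightarrow> int) \<Rightarrow> ((int \<Rightarrow> nat \<Rightarrow> int) \<times> int) set" where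
  "periodic_lamps n p k N = {(f, l). (f, l) \<in> carrier (lamplighter n p) \<and> k dvd l \<and>
     (\<forall>x i. 0 < i \<longrightarrow> f x i = 0) \<and>
     (\<exists>h::int \<Rightarrow> int. finite {x. h x \<noteq> 0} \<and> (\<forall>x. f x 0 = (h x - h (x - k * N (x mod k))) mod int p))}"

lemma periodic_lamps_iff:
  "(f, l) \<in> periodic_lamps n p k N \<longleftrightarrow> (f, l) \<in> carrier (lamplighter n p) \<and> k dvd l \<and>
     (\<forall>x i. 0 < i \<longrightarrow> f x i = 0) \<and>
     (\<exists>h::int \<Rightarrow> int. finite {x. h x \<noteq> 0} \<and> (\<forall>x. f x 0 = (h x - h (x - k * N (x mod k))) mod int p))"
  by (simp add: periodic_lamps_def)

lemma mod_diff_mult_self: "(x - k * c) mod k = x mod (k::int)"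
  using mod_mult_self2[of x k "- c"] by simp

context lamplighter_params
begin

lemma periodic_lamps_subgroup: "periodic_lamps n p k N \<in> lamp_subgroups n p"
  unfolding lamp_subgroups_iff
proof (intro conjI allI impI)
  show "periodic_lamps n p k N \<subseteq> carrier (lamplighter n p)" by (auto simp: periodic_lamps_def)
  have "(\<lambda>x i. 0, 0) \<in> carrier (lamplighter n p)" using p_gt_1 by (simp add: carrier_iff)
  then show "(\<lambda>x i. 0, 0) \<in> periodic_lamps n p k N"
    unfolding periodic_lamps_iff by (auto intro!: exI[of _ "\<lambda>_. 0"])
next
  fix f l f' l' assume f: "(f, l) \<in> periodic_lamps n p k N" and f': "(f', l') \<in> periodic_lamps n p k N"
  obtain h where h: "finite {x. h x \<noteq> 0}" "\<And>x. f x 0 = (h x - h (x - k * N (x mod k))) mod int p"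
    using f unfolding periodic_lamps_iff by blast
  obtain h' where h': "finite {x. h' x \<noteq> 0}" "\<And>x. f' x 0 = (h' x - h' (x - k * N (x mod k))) mod int p"
    using f' unfolding periodic_lamps_iff by blast
  have kl: "k dvd l" using f by (simp add: periodic_lamps_iff)
  \<comment> \<open>Translation by a multiple of \<open>k\<close> preserves residue classes, hence
    the values of \<open>N\<close>, so the cofactors add up after translating
    \<open>h'\<close>.\<close>
  have md: "(x - l) mod k = x mod k" for x
    using kl mod_diff_right_eq[of x l k] by simp
  define g where "g = (\<lambda>x. h x + h' (x - l))"
  have "finite ({x. h x \<noteq> 0} \<union> {x. h' (x - l) \<noteq> 0})"
    using h(1) h'(1) finite_Collect_shift[of "\<lambda>x. h' x \<noteq> 0" l] by simp
  then have "finite {x. g x \<noteq> 0}" by (rule rev_finite_subset) (auto simp: g_def)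
  moreover have "(f x 0 + f' (x - l) 0) mod int p = (g x - g (x - k * N (x mod k))) mod int p" for x
    unfolding h(2) h'(2) md g_def mod_add_eq by (simp add: algebra_simps)
  moreover have "(\<lambda>x i. (f x i + f' (x - l) i) mod int p, l + l') \<in> carrier (lamplighter n p)"
    using f f' mult_closed[of f l f' l'] unfolding periodic_lamps_iff by blast
  ultimately show "(\<lambda>x i. (f x i + f' (x - l) i) mod int p, l + l') \<in> periodic_lamps n p k N"
    using f f' unfolding periodic_lamps_iff by auto
next
  fix f l assume f: "(f, l) \<in> periodic_lamps n p k N"
  obtain h where h: "finite {x. h x \<noteq> 0}" "\<And>x. f x 0 = (h x - h (x - k * N (x mod k))) mod int p"
    using f unfolding periodic_lamps_iff by blast
  have kl: "k dvd l" using f by (simp add: periodic_lamps_iff)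
  have md: "(x + l) mod k = x mod k" for x
    using kl mod_add_right_eq[of x l k] by simp
  define g where "g = (\<lambda>x. - h (x + l))"
  have "finite {x. g x \<noteq> 0}"
    using h(1) finite_Collect_shift[of "\<lambda>x. h x \<noteq> 0" "- l"] by (simp add: g_def)
  moreover have "(- f (x + l) 0) mod int p = (g x - g (x - k * N (x mod k))) mod int p" for x
    unfolding h(2) md g_def mod_minus_eq by (simp add: algebra_simps)
  moreover have "(\<lambda>x i. (- f (x + l) i) mod int p, - l) \<in> carrier (lamplighter n p)"
    using f inv_closed[of f l] unfolding periodic_lamps_iff by blast
  ultimately show "(\<lambda>x i. (- f (x + l) i) mod int p, - l) \<in> periodic_lamps n p k N"
    using f unfolding periodic_lamps_iff by auto
qed

lemma periodic_lamps_not_base: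
  assumes "k \<noteq> 0"
  shows "periodic_lamps n p k N \<notin> base_subgroups n p"
proof -
  have "(\<lambda>x i. 0, k) \<in> carrier (lamplighter n p)" using p_gt_1 by (simp add: carrier_iff)
  then have "(\<lambda>x i. 0, k) \<in> periodic_lamps n p k N"
    unfolding periodic_lamps_iff by (auto intro!: exI[of _ "\<lambda>_. 0"])
  then show ?thesis using assms by (auto simp: base_subgroups_def)
qed

text \<open>A nonzero multiple of \<open>1 - t ^ (k * M)\<close> has support of diameter at least
  \<open>k * M\<close>, too wide for an \<open>f\<close> supported on [-D, D]. So \<open>f\<close>
  vanishes on the class of \<open>r\<close>, just as \<open>N r = 0\<close> demands.\<close>

lemma periodic_lamps_update_iff:
  assumes k: "0 < k" and M: "2 * D < M" and D: "\<And>x. f x 0 \<noteq> 0 \<Longrightarrow> \<bar>x\<bar> \<le> D"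
    and D0: "0 \<le> D" and r: "r mod k = r" "N r = 0"
  shows "(f, l) \<in> periodic_lamps n p k (N(r := M)) \<longleftrightarrow> (f, l) \<in> periodic_lamps n p k N"
proof
  assume f: "(f, l) \<in> periodic_lamps n p k (N(r := M))"
  obtain h where h: "finite {x. h x \<noteq> 0}"
      "\<And>x. f x 0 = (h x - h (x - k * (N(r := M)) (x mod k))) mod int p"
    using f unfolding periodic_lamps_iff by blast
  have fr: "f x 0 = (h x - h (x - k * M)) mod int p" if "x mod k = r" for x
    using h(2)[of x] that by simp
  \<comment> \<open>Cofactors are integer valued, so they matter only modulo
    \<open>p\<close>.\<close>
  define S where "S = {x. x mod k = r \<and> h x mod int p \<noteq> 0}"
  have "finite S" by (rule finite_subset[OF _ h(1)]) (auto simp: S_def)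
  have kM: "M \<le> k * M" using k M D0 mult_right_mono[of 1 k M] by simp
  have "S = {}"
  proof (rule ccontr)
    assume "S \<noteq> {}"
    define a b where "a = Min S" and "b = Max S"
    have a: "a \<in> S" "\<And>x. x \<in> S \<Longrightarrow> a \<le> x" and b: "b \<in> S" "\<And>x. x \<in> S \<Longrightarrow> x \<le> b"
      using \<open>finite S\<close> \<open>S \<noteq> {}\<close> by (simp_all add: a_def b_def)
    have kM0: "0 < k * M" using kM M D0 by linarith
    note sh = mod_diff_mult_self[of _ k M] mod_mult_self2[of _ k M]
    \<comment> \<open>Beyond the extreme positions \<open>a\<close> and \<open>b\<close> of
      \<open>S\<close> nothing cancels, so \<open>f\<close> is nonzero at both \<open>a\<close> and
      \<open>b + k * M\<close>.\<close>
    have "a - k * M \<notin> S" using a(2)[of "a - k * M"] kM0 by auto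
    then have "h (a - k * M) mod int p = 0" using a(1) sh by (simp add: S_def)
    then have "f a 0 = h a mod int p"
      using fr[of a] a(1) mod_diff_right_eq[of "h a" "h (a - k * M)" "int p"] by (simp add: S_def)
    then have fa: "\<bar>a\<bar> \<le> D" using D[of a] a(1) by (simp add: S_def)
    have "b + k * M \<notin> S" using b(2)[of "b + k * M"] kM0 by auto
    then have "h (b + k * M) mod int p = 0" using b(1) sh by (simp add: S_def)
    then have "f (b + k * M) 0 = (- h b) mod int p"
      using fr[of "b + k * M"] b(1) sh mod_diff_left_eq[of "h (b + k * M)" "int p" "h b"]
      by (simp add: S_def)
    moreover have "(- h b) mod int p \<noteq> 0" using b(1) by (simp add: S_def mod_eq_0_iff_dvd)
    ultimately have fb: "\<bar>b + k * M\<bar> \<le> D" using D by metis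
    show False using fa fb a(2)[OF b(1)] kM M by linarith
  qed
  then have hz: "h x mod int p = 0" if "x mod k = r" for x using that by (auto simp: S_def)
  have "f x 0 = (h x - h (x - k * N (x mod k))) mod int p" for x
  proof (cases "x mod k = r")
    case True
    have "(x - k * M) mod k = r" using True by (simp add: mod_diff_mult_self)
    then have "f x 0 = 0"
      using fr[OF True] hz[OF True] hz[of "x - k * M"] by (simp add: mod_eq_0_iff_dvd)
    then show ?thesis using r True by simp
  next
    case False
    then show ?thesis using h(2)[of x] by simp
  qed
  then show "(f, l) \<in> periodic_lamps n p k N"
    using f h(1) unfolding periodic_lamps_iff by blast
next
  assume f: "(f, l) \<in> periodic_lamps n p k N"
  obtain h where h: "finite {x. h x \<noteq> 0}" "\<And>x. f x 0 = (h x - h (x - k * N (x mod k))) mod int p"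
    using f unfolding periodic_lamps_iff by blast
  \<comment> \<open>With \<open>N r = 0\<close> the cofactor has no effect on the class of
    \<open>r\<close>, so it may be replaced by zero there.\<close>
  define g where "g = (\<lambda>x. if x mod k = r then 0 else h x)"
  have "finite {x. g x \<noteq> 0}" by (rule finite_subset[OF _ h(1)]) (auto simp: g_def)
  moreover have "f x 0 = (g x - g (x - k * (N(r := M)) (x mod k))) mod int p" for x
    using h(2)[of x] r by (auto simp: g_def mod_diff_mult_self)
  ultimately show "(f, l) \<in> periodic_lamps n p k (N(r := M))"
    using f unfolding periodic_lamps_iff by blast
qed

lemma periodic_lamps_update_neq:
  assumes k: "0 < k" and M: "0 < M" and r: "r mod k = r" "N r = 0"
  shows "periodic_lamps n p k (N(r := M)) \<noteq> periodic_lamps n p k N"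
proof -
  \<comment> \<open>The generator \<open>1 - t ^ (k * M)\<close> at site \<open>r\<close> separates
    the two subgroups: its entry at \<open>r\<close> is 1, whereas \<open>N r = 0\<close> forces the
    entry 0.\<close>
  define h where "h = (\<lambda>x. if x = r then 1 else 0 :: int)"
  define f where "f = (\<lambda>x i. if i = (0::nat) then (h x - h (x - k * (N(r := M)) (x mod k))) mod int p else 0)"
  have "{x. f x 0 \<noteq> 0} \<subseteq> {r, r + k * M}"
  proof
    fix x assume "x \<in> {x. f x 0 \<noteq> 0}"
    then have "x = r \<or> x - k * (N(r := M)) (x mod k) = r" by (auto simp: f_def h_def)
    moreover have "(x - k * (N(r := M)) (x mod k)) mod k = x mod k" by (rule mod_diff_mult_self)
    ultimately show "x \<in> {r, r + k * M}" using r(1) by auto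
  qed
  moreover have "{x. \<exists>i. f x i \<noteq> 0} = {x. f x 0 \<noteq> 0}" by (auto simp: f_def)
  ultimately have "finite {x. \<exists>i. f x i \<noteq> 0}" by (simp add: finite_subset)
  then have "(f, 0) \<in> carrier (lamplighter n p)"
    using p_gt_1 n_pos by (simp add: carrier_iff f_def)
  moreover have "finite {x. h x \<noteq> 0}" by (simp add: h_def)
  ultimately have "(f, 0) \<in> periodic_lamps n p k (N(r := M))"
    unfolding periodic_lamps_iff by (auto simp: f_def intro!: exI[of _ h])
  moreover have "(f, 0) \<notin> periodic_lamps n p k N"
  proof
    assume "(f, 0) \<in> periodic_lamps n p k N"
    then have "f r 0 = 0" using r unfolding periodic_lamps_iff by auto
    moreover have "f r 0 = 1" using k M r p_gt_1 by (simp add: f_def h_def)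
    ultimately show False by simp
  qed
  ultimately show ?thesis by blast
qed

text \<open>Replacing one zero value of \<open>N\<close> by a large \<open>M\<close> gives different
  subgroups arbitrarily close by. They have one zero fewer, so by induction they still lie in the
  preceding derivative.\<close>

lemma periodic_lamps_in_funpow:
  assumes k: "0 < k"
  shows "m \<le> card {r \<in> {0..<k}. N r = 0} \<Longrightarrow>
           periodic_lamps n p k N \<in> (accum_subgroups ^^ m) (lamp_subgroups n p)"
proof (induction m arbitrary: N)
  case 0
  then show ?case using periodic_lamps_subgroup by simp
next
  case (Suc m)
  let ?Z = "\<lambda>N. {r \<in> {0..<k}. N r = 0}"
  have "?Z N \<noteq> {}" using Suc.prems by (metis card.empty not_less_eq_eq zero_le)
  then obtain r where r: "r \<in> {0..<k}" "N r = 0" by auto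
  then have rk: "r mod k = r" by simp
  have near: "\<exists>H'\<in>(accum_subgroups ^^ m) (lamp_subgroups n p).
      H' \<noteq> periodic_lamps n p k N \<and> H' \<inter> F = periodic_lamps n p k N \<inter> F" if F: "finite F" for F
  proof -
    define Y where "Y = (\<Union>(f, l) \<in> F \<inter> carrier (lamplighter n p). {x. \<exists>i. f x i \<noteq> 0})"
    have "finite Y" using F unfolding Y_def by (intro finite_UN_I) (auto simp: carrier_iff)
    from finite_int_abs_bounded[OF this] obtain D where D: "\<forall>x\<in>Y. \<bar>x\<bar> \<le> D" by (elim exE)
    define M where "M = 2 * \<bar>D\<bar> + 1"
    have "?Z (N(r := M)) = ?Z N - {r}" using r by (auto simp: M_def)
    then have "m \<le> card (?Z (N(r := M)))" using Suc.prems r by (simp add: card_Diff_singleton)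
    then have "periodic_lamps n p k (N(r := M)) \<in> (accum_subgroups ^^ m) (lamp_subgroups n p)"
      by (rule Suc.IH)
    moreover have "periodic_lamps n p k (N(r := M)) \<noteq> periodic_lamps n p k N"
      by (intro periodic_lamps_update_neq k rk r(2)) (simp add: M_def)
    moreover have "(f, l) \<in> periodic_lamps n p k (N(r := M)) \<longleftrightarrow> (f, l) \<in> periodic_lamps n p k N"
      if fF: "(f, l) \<in> F" for f l
    proof (cases "(f, l) \<in> carrier (lamplighter n p)")
      case True
      have "\<bar>x\<bar> \<le> \<bar>D\<bar>" if "f x 0 \<noteq> 0" for x
      proof -
        have "x \<in> Y" using True fF that unfolding Y_def by blast
        then show ?thesis using D by auto
      qed
      then show ?thesis
        by (intro periodic_lamps_update_iff[where D = "\<bar>D\<bar>"]) (use k rk r(2) in \<open>simp_all add: M_def\<close>)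
    qed (simp add: periodic_lamps_iff)
    then have "periodic_lamps n p k (N(r := M)) \<inter> F = periodic_lamps n p k N \<inter> F" by auto
    ultimately show ?thesis by blast
  qed
  have "periodic_lamps n p k N \<in> (accum_subgroups ^^ m) (lamp_subgroups n p)"
    using Suc.IH[of N] Suc.prems by simp
  then show ?case
    using near by (simp add: accum_subgroups_def[of "(accum_subgroups ^^ m) (lamp_subgroups n p)"])
qed

end

subsection \<open>The perfect kernel and the rank\<close>

context lamplighter_params
begin

text \<open>All other subgroups near \<open>H\<close> have smaller rank and have disappeared by
  stage \<open>m\<close>, so \<open>H\<close> is at best isolated there and is removed in the next
  step.\<close>

lemma nonbase_not_in_funpow:
  assumes "H \<in> lamp_subgroups n p" "H \<notin> base_subgroups n p"
  shows "lamp_rank n p H < m \<Longrightarrow> H \<notin> (accum_subgroups ^^ m) (lamp_subgroups n p)"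
  using assms
proof (induction m arbitrary: H)
  case (Suc m)
  let ?Y = "(accum_subgroups ^^ m) (lamp_subgroups n p)"
  obtain F where F: "finite F"
    "\<And>H'. H' \<in> lamp_subgroups n p \<Longrightarrow> H' \<inter> F = H \<inter> F \<Longrightarrow>
       H' = H \<or> H' \<notin> base_subgroups n p \<and> lamp_rank n p H' < lamp_rank n p H"
    using lamp_rank_drops_nearby[OF Suc.prems(2,3)] by metis
  show ?case
  proof
    assume "H \<in> (accum_subgroups ^^ Suc m) (lamp_subgroups n p)"
    then have "\<exists>H'\<in>?Y. H' \<noteq> H \<and> H' \<inter> F = H \<inter> F"
      using F(1) by (simp add: accum_subgroups_def[of ?Y])
    then obtain H' where H': "H' \<in> ?Y" "H' \<noteq> H" "H' \<inter> F = H \<inter> F" by (elim bexE conjE)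
    have "H' \<in> lamp_subgroups n p" using H'(1) accum_subgroups_funpow_subset by (rule rev_subsetD)
    then have "H' \<notin> ?Y" using F(2)[of H'] H' Suc.IH[of H'] Suc.prems(1) by auto
    then show False using H'(1) by contradiction
  qed
qed simp

text \<open>An uncountable neighbourhood cannot consist of \<open>H\<close> alone.\<close>

lemma accum_base_subgroups: "accum_subgroups (base_subgroups n p) = base_subgroups n p"
proof
  show "base_subgroups n p \<subseteq> accum_subgroups (base_subgroups n p)"
    unfolding accum_subgroups_def
  proof (intro subsetI CollectI conjI allI impI)
    fix H and F :: "((int \<Rightarrow> nat \<Rightarrow> int) \<times> int) set"
    assume H: "H \<in> base_subgroups n p" and F: "finite F"
    have "\<not> {H' \<in> base_subgroups n p. H' \<inter> F = H \<inter> F} \<subseteq> {H}"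
      using uncountable_base_nbhd[OF H F] countable_subset[of _ "{H}"] by auto
    then show "\<exists>H'\<in>base_subgroups n p. H' \<noteq> H \<and> H' \<inter> F = H \<inter> F" by blast
  qed
qed (rule accum_subgroups_subset)

abbreviation "lamp_space \<equiv> Sub_top (lamplighter n p)"
abbreviation "lamp_char \<equiv> sub_char (lamplighter n p)"

lemma topspace_lamp_space: "topspace lamp_space = lamp_char ` lamp_subgroups n p"
  by (simp add: topspace_Sub_top lamp_subgroups_def)

lemma cb_iter_lamp_space:
  "cb_iter lamp_space m = lamp_char ` (accum_subgroups ^^ m) (lamp_subgroups n p)"
  by (simp add: cb_iter_Sub_top lamp_subgroups_def)

lemma lamp_char_eq_iff:
  "H \<in> lamp_subgroups n p \<Longrightarrow> H' \<in> lamp_subgroups n p \<Longrightarrow> lamp_char H = lamp_char H' \<longleftrightarrow> H = H'"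
  by (simp add: lamp_subgroups_def sub_char_eq_iff)

lemma base_subset_lamp: "base_subgroups n p \<subseteq> lamp_subgroups n p"
  by (auto simp: base_subgroups_def)

lemma cb_deriv_base: "cb_deriv lamp_space (lamp_char ` base_subgroups n p) = lamp_char ` base_subgroups n p"
  using cb_deriv_Sub_top[of "base_subgroups n p" "lamplighter n p"] base_subset_lamp
  by (simp add: accum_base_subgroups lamp_subgroups_def)

lemma closedin_base: "closedin lamp_space (lamp_char ` base_subgroups n p)"
  unfolding closedin_contains_derived_set
proof
  show "lamp_char ` base_subgroups n p \<subseteq> topspace lamp_space"
    using base_subset_lamp by (auto simp: topspace_lamp_space)
  show "lamp_space derived_set_of lamp_char ` base_subgroups n p \<subseteq> lamp_char ` base_subgroups n p"
  proof
    fix y assume y: "y \<in> lamp_space derived_set_of lamp_char ` base_subgroups n p"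
    then have "y \<in> topspace lamp_space" using derived_set_of_subset_topspace by (rule rev_subsetD)
    then obtain H where H: "H \<in> lamp_subgroups n p" "y = lamp_char H" by (auto simp: topspace_lamp_space)
    then have nb: "\<forall>F. finite F \<longrightarrow> (\<exists>H'\<in>base_subgroups n p. H' \<noteq> H \<and> H' \<inter> F = H \<inter> F)"
      using y derived_set_of_Sub_top_iff[of H "lamplighter n p" "base_subgroups n p"] base_subset_lamp
      by (simp add: lamp_subgroups_def)
    \<comment> \<open>Testing a single element is enough: a base subgroup containing
      \<open>(f, k)\<close> forces \<open>k = 0\<close>.\<close>
    have "k = 0" if "(f, k) \<in> H" for f k
    proof -
      obtain H' where "H' \<in> base_subgroups n p" "H' \<inter> {(f, k)} = H \<inter> {(f, k)}"
        using nb[rule_format, of "{(f, k)}"] by auto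
      then show ?thesis using that by (auto simp: base_subgroups_def)
    qed
    then have "H \<in> base_subgroups n p" using H by (auto simp: base_subgroups_def)
    then show "y \<in> lamp_char ` base_subgroups n p" using H by simp
  qed
qed

lemma cb_omega_lamp_space: "cb_omega lamp_space = lamp_char ` base_subgroups n p"
proof
  show "lamp_char ` base_subgroups n p \<subseteq> cb_omega lamp_space"
    using perfect_subset_cb_omega[OF _ cb_deriv_base] closedin_subset[OF closedin_base] by blast
  show "cb_omega lamp_space \<subseteq> lamp_char ` base_subgroups n p"
  proof
    fix y assume "y \<in> cb_omega lamp_space"
    then have y: "y \<in> lamp_char ` (accum_subgroups ^^ m) (lamp_subgroups n p)" for m
      by (auto simp: cb_omega_def cb_iter_lamp_space)
    obtain H where H: "H \<in> lamp_subgroups n p" "y = lamp_char H" using y[of 0] by auto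
    \<comment> \<open>The first stage at which a subgroup outside the base group with the rank of
      \<open>H\<close> must be gone.\<close>
    obtain H' where H': "H' \<in> (accum_subgroups ^^ Suc (lamp_rank n p H)) (lamp_subgroups n p)" "y = lamp_char H'"
      using y[of "Suc (lamp_rank n p H)"] by (rule imageE)
    have "H' \<in> lamp_subgroups n p" using H'(1) accum_subgroups_funpow_subset by (rule rev_subsetD)
    then have "H' = H" using H H' lamp_char_eq_iff by simp
    then have "H \<in> base_subgroups n p"
      using nonbase_not_in_funpow[OF H(1) _ lessI] H'(1) by blast
    then show "y \<in> lamp_char ` base_subgroups n p" using H by simp
  qed
qed

text \<open>For uniqueness, a competitor \<open>K\<close> lies in the omega stage because it equals
  its derivative. If the closed set \<open>K\<close> missed a subgroup of the base group, it would
  miss an uncountable neighbourhood of it, contradicting its countable complement.\<close>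

lemma perfect_kernel_lamp_space: "perfect_kernel lamp_space = lamp_char ` base_subgroups n p"
  unfolding perfect_kernel_def
proof (rule the_equality)
  have "topspace lamp_space - lamp_char ` base_subgroups n p
          \<subseteq> lamp_char ` (lamp_subgroups n p - base_subgroups n p)"
    by (auto simp: topspace_lamp_space)
  then have "countable (topspace lamp_space - lamp_char ` base_subgroups n p)"
    using countable_nonbase by (rule countable_subset[OF _ countable_image])
  then show "lamp_char ` base_subgroups n p \<subseteq> topspace lamp_space \<and>
      closedin lamp_space (lamp_char ` base_subgroups n p) \<and>
      cb_deriv lamp_space (lamp_char ` base_subgroups n p) = lamp_char ` base_subgroups n p \<and>
      countable (topspace lamp_space - lamp_char ` base_subgroups n p)"
    using closedin_base cb_deriv_base closedin_subset by blast
next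
  fix K assume K: "K \<subseteq> topspace lamp_space \<and> closedin lamp_space K \<and> cb_deriv lamp_space K = K \<and>
      countable (topspace lamp_space - K)"
  have "lamp_char H \<in> K" if H: "H \<in> base_subgroups n p" for H
  proof (rule ccontr)
    assume HK: "lamp_char H \<notin> K"
    define S where "S = {H' \<in> lamp_subgroups n p. lamp_char H' \<in> K}"
    have KS: "K = lamp_char ` S" using K by (auto simp: S_def topspace_lamp_space)
    have "lamp_char H \<notin> lamp_space derived_set_of (lamp_char ` S)"
      using K HK unfolding KS closedin_contains_derived_set by blast
    moreover have "H \<in> lamp_subgroups n p" "S \<subseteq> lamp_subgroups n p"
      using H base_subset_lamp by (auto simp: S_def)
    ultimately obtain F where F: "finite F" "\<not> (\<exists>H'\<in>S. H' \<noteq> H \<and> H' \<inter> F = H \<inter> F)"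
      using derived_set_of_Sub_top_iff[of H "lamplighter n p" S] by (auto simp: lamp_subgroups_def)
    let ?N = "{H' \<in> base_subgroups n p. H' \<inter> F = H \<inter> F}"
    have "lamp_char ` ?N \<subseteq> topspace lamp_space - K"
    proof (rule image_subsetI)
      fix H' assume H': "H' \<in> ?N"
      then have lamp: "H' \<in> lamp_subgroups n p" using base_subset_lamp by auto
      have "H' \<notin> S"
      proof
        assume "H' \<in> S"
        then have "H' = H" using F(2) H' by auto
        then show False using \<open>H' \<in> S\<close> HK by (simp add: S_def)
      qed
      then show "lamp_char H' \<in> topspace lamp_space - K"
        using lamp by (simp add: S_def topspace_lamp_space)
    qed
    moreover have "countable (topspace lamp_space - K)" using K by (elim conjE)
    ultimately have "countable (lamp_char ` ?N)" by (rule countable_subset)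
    moreover have "inj_on lamp_char ?N"
      by (rule inj_onI) (use base_subset_lamp lamp_char_eq_iff in \<open>simp add: subset_iff\<close>)
    ultimately have "countable ?N" by (rule countable_image_inj_on)
    then show False using uncountable_base_nbhd[OF H F(1)] by contradiction
  qed
  then have "lamp_char ` base_subgroups n p \<subseteq> K" by (rule image_subsetI)
  moreover have "K \<subseteq> lamp_char ` base_subgroups n p"
    using perfect_subset_cb_omega[of K lamp_space] K by (simp add: cb_omega_lamp_space)
  ultimately show "K = lamp_char ` base_subgroups n p" by blast
qed

lemma cb_iter_lamp_space_not_stationary: "cb_iter lamp_space (Suc m) \<noteq> cb_iter lamp_space m"
proof
  assume "cb_iter lamp_space (Suc m) = cb_iter lamp_space m"
  then have eq: "lamp_char ` base_subgroups n p
               = lamp_char ` (accum_subgroups ^^ m) (lamp_subgroups n p)"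
    using cb_omega_eq_if_stationary cb_omega_lamp_space cb_iter_lamp_space by metis
  \<comment> \<open>The cyclic group generated by translation by \<open>m + 1\<close>, with trivial
    lamp part. All \<open>m + 1\<close> classes are zero summands, one more than \<open>m\<close>
    stages require; this keeps the step positive also for \<open>m = 0\<close>.\<close>
  define P where "P = periodic_lamps n p (int (Suc m)) (\<lambda>_. 0)"
  have "{r \<in> {0..<int (Suc m)}. (0::int) = 0} = {0..<int (Suc m)}" by auto
  then have "P \<in> (accum_subgroups ^^ m) (lamp_subgroups n p)"
    unfolding P_def by (intro periodic_lamps_in_funpow) simp_all
  then have "lamp_char P \<in> lamp_char ` base_subgroups n p" unfolding eq by (rule imageI)
  then obtain H where H: "H \<in> base_subgroups n p" "lamp_char P = lamp_char H" by (rule imageE)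
  have "P \<in> lamp_subgroups n p" unfolding P_def by (rule periodic_lamps_subgroup)
  moreover have "H \<in> lamp_subgroups n p" using H(1) base_subset_lamp by (rule rev_subsetD)
  ultimately have "P \<in> base_subgroups n p" using H lamp_char_eq_iff by simp
  moreover have "P \<notin> base_subgroups n p"
    unfolding P_def by (rule periodic_lamps_not_base) simp
  ultimately show False by contradiction
qed

end

theorem theorem1p1:
  fixes n p :: nat
  assumes "Factorial_Ring.prime p" and "1 \<le> n"
  shows "perfect_kernel (Sub_top (lamplighter n p))
           = sub_char (lamplighter n p) ` {H. subgroup H (lamp_base n p)}
         \<and> cb_rank_is_omega (Sub_top (lamplighter n p))"
proof -
  interpret lamplighter_params n p by unfold_locales (use assms in auto)
  show ?thesis
    unfolding base_subgroups_eq cb_rank_is_omega_def cb_omega_lamp_space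
    using perfect_kernel_lamp_space cb_iter_lamp_space_not_stationary cb_deriv_base by blast
qed

end
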